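(* Consider, for small real parameters $a_{20},a_{21},a_{01},a_{02},a_{03},b_{30},b_{11},b_{12}$, the system \[ \dot x = y + a_{20}(x^2-1) + a_{21}x^2y + a_{01}y + a_{02}y^2 + a_{03}y^3,\qquad \dot y = x - x^3 + b_{30}(x^3-x) + b_{11}xy + b_{12}xy^2 . \] It has singular points at $(\pm1,0)$. It has a non-degenerate real center at $(\pm1,0)$ if and only if $2a_{20}+b_{11}=0$ and at least one of the following holds: (i) $a_{21}+b_{12}=0$ (Hamiltonian case); (ii) $(1-b_{30})a_{02}=a_{20}(2a_{21}-b_{12})$ (pull-back case). Moreover, in case (ii) the system is a polynomial pull-back of a linear planar system under the map \[ (x,y)\mapsto \bigl(x^2-1+P_2(y),\ y^2\bigr),\qquad P_2(y)=\frac{1}{b_{30}-1}\bigl(b_{11}y+b_{12}y^2\bigr). \]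
   Context: This system is the normal form, obtained after an affine change $(x,y)\mapsto(\alpha x,y+\beta)$, of the $x$-reversible cubic perturbation $\dot x=y+P(x,y)$, $\dot y=x-x^3+Q(x,y)$ of the Hamiltonian system $\dot x=y$, $\dot y=x-x^3$. Here $P(-x,y)=P(x,y)$ and $Q(-x,y)=-Q(x,y)$. The trace of the linearization at $(\pm1,0)$ equals $2a_{20}+b_{11}$. A system is a polynomial pull-back of a system $Y$ under a polynomial map $\Phi$ if its orbit foliation is the pull-back under $\Phi$ of the orbit foliation of $Y$. *)

theory Defs
  imports "HOL-Analysis.Analysis"
begin

definition cross2 :: "real \<times> real \<Rightarrow> real \<times> real \<Rightarrow> real" where
  "cross2 u v = fst u * snd v - snd u * fst v"

definition periodic_orbit_in :: "(real \<times> real \<Rightarrow> real \<times> real) \<Rightarrow> real \<times> real \<Rightarrow> (real \<times> real) set \<Rightarrow> bool" where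
  "periodic_orbit_in F q S \<longleftrightarrow>
     (\<exists>(z :: real \<Rightarrow> real \<times> real) T. T > 0 \<and> z 0 = q \<and>
        (\<forall>t. (z has_vector_derivative F (z t)) (at t)) \<and>
        (\<forall>t. z (t + T) = z t) \<and> (\<forall>t. z t \<in> S))"

definition is_center :: "(real \<times> real \<Rightarrow> real \<times> real) \<Rightarrow> real \<times> real \<Rightarrow> bool" where
  "is_center F p \<longleftrightarrow> F p = 0 \<and>
     (\<exists>U. open U \<and> p \<in> U \<and> simply_connected U \<and>
        (\<forall>q \<in> U - {p}. F q \<noteq> 0 \<and> periodic_orbit_in F q (U - {p})))"

definition nondeg_center :: "(real \<times> real \<Rightarrow> real \<times> real) \<Rightarrow> real \<times> real \<Rightarrow> bool" where
  "nondeg_center F p \<longleftrightarrow> is_center F p \<and>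
     (\<exists>L. (F has_derivative L) (at p) \<and> cross2 (L (1, 0)) (L (0, 1)) \<noteq> 0)"

text \<open>The orbit foliation of F is the pull-back under \<Phi> of that of Y:
  at every point the image of F under D\<Phi> is parallel to Y at \<Phi>(z).\<close>
definition pullback_foliation ::
  "(real \<times> real \<Rightarrow> real \<times> real) \<Rightarrow> (real \<times> real \<Rightarrow> real \<times> real) \<Rightarrow> (real \<times> real \<Rightarrow> real \<times> real) \<Rightarrow> bool" where
  "pullback_foliation F \<Phi> Y \<longleftrightarrow>
     (\<forall>z. \<exists>D. (\<Phi> has_derivative D) (at z) \<and> cross2 (D (F z)) (Y (\<Phi> z)) = 0)"

definition linear_planar_field :: "(real \<times> real \<Rightarrow> real \<times> real) \<Rightarrow> bool" where
  "linear_planar_field Y \<longleftrightarrow>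
     (\<exists>\<alpha> \<beta> e \<gamma> \<delta> f. (\<alpha>, \<beta>, e, \<gamma>, \<delta>, f) \<noteq> (0, 0, 0, 0, 0, 0) \<and>
        (\<forall>u v. Y (u, v) = (\<alpha> * u + \<beta> * v + e, \<gamma> * u + \<delta> * v + f)))"

definition sysF :: "real \<Rightarrow> real \<Rightarrow> real \<Rightarrow> real \<Rightarrow> real \<Rightarrow> real \<Rightarrow> real \<Rightarrow> real \<Rightarrow>
    real \<times> real \<Rightarrow> real \<times> real" where
  "sysF a20 a21 a01 a02 a03 b30 b11 b12 = (\<lambda>(x, y).
     (y + a20 * (x^2 - 1) + a21 * x^2 * y + a01 * y + a02 * y^2 + a03 * y^3,
      x - x^3 + b30 * (x^3 - x) + b11 * x * y + b12 * x * y^2))"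

definition pbmap :: "real \<Rightarrow> real \<Rightarrow> real \<Rightarrow> real \<times> real \<Rightarrow> real \<times> real" where
  "pbmap b30 b11 b12 = (\<lambda>(x, y).
     (x^2 - 1 + (1 / (b30 - 1)) * (b11 * y + b12 * y^2), y^2))"

end

theory Submission
  imports Defs
begin

text \<open>Write \<open>b = 1 - b30\<close>. With \<open>v = b11 y + b12 y\<^sup>2 - b (x\<^sup>2 - 1)\<close> the system is, up to the time
  factor \<open>x\<close>, the Lienard system \<open>y' = v, v' = (tr + k y) v - g y\<close> with
  \<open>tr = 2 a20 + b11\<close>, \<open>k = 2 (a21 + b12)\<close> and a cubic \<open>g y = g1 y + g2 y\<^sup>2 + g3 y\<^sup>3\<close>.
  If \<open>tr \<noteq> 0\<close>, or if \<open>tr = 0\<close> and \<open>k g2 \<noteq> 0\<close>, an energy \<open>G y + B v\<close> with \<open>G' = g\<close> is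
  monotone along orbits and forbids periodic orbits close to the singular point. If \<open>tr = 0\<close> and
  \<open>k g2 = 0\<close>, dividing \<open>v\<close> by a suitable function of \<open>y\<close> separates the variables; straightening
  each of them turns the orbits into circles, and the motion on a circle is found by a single
  quadrature, so that no existence theorem for differential equations is needed.\<close>

section \<open>Antiderivatives and motion on a circle by quadrature\<close>

lemma continuous_antiderivative_UNIV:
  fixes f :: "real \<Rightarrow> real"
  assumes "continuous_on UNIV f"
  obtains G where "\<And>x. (G has_real_derivative f x) (at x)"
proof
  define G where "G u = (LBINT t=0..u. f t)" for u :: real
  fix x :: real
  \<comment> \<open>\<open>{a..b}\<close> has both \<open>0\<close> and \<open>x\<close> in its
    interior, so the derivative within the interval is a full derivative at
    \<open>x\<close>.\<close>
  define a b where "a = min 0 x - 1" and "b = max 0 x + 1"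
  have ab: "a < 0" "0 < b" "a < x" "x < b" by (auto simp: a_def b_def)
  have "(G has_vector_derivative f x) (at x within {a..b})"
    unfolding G_def zero_ereal_def
    by (rule interval_integral_FTC2)
      (use ab assms in \<open>auto intro: continuous_on_subset\<close>)
  moreover have "at x within {a..b} = at x"
    using ab by (intro at_within_interior) auto
  ultimately show "(G has_real_derivative f x) (at x)"
    by (simp add: has_real_derivative_iff_has_vector_derivative)
qed

text \<open>Separation of variables for \<open>\<phi>' = w \<phi>\<close>: the antiderivative
  \<open>G\<close> of \<open>1 / w\<close> is elapsed time as a function of the angle, and its
  inverse is the flow. The upper bound on \<open>w\<close> makes every time attained; the
  periodicity of \<open>w\<close> makes every full turn take equally long.\<close>

lemma circle_rotation_flow:
  fixes w :: "real \<Rightarrow> real"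
  assumes cont: "continuous_on UNIV w" and pos: "\<And>\<theta>. 0 < w \<theta>"
    and bnd: "\<And>\<theta>. w \<theta> \<le> M" and per: "\<And>\<theta>. w (\<theta> + 2 * pi) = w \<theta>"
  obtains \<phi> T where "T > 0" "\<phi> 0 = \<theta>0" "\<And>t. (\<phi> has_real_derivative w (\<phi> t)) (at t)"
    "\<And>t. \<phi> (t + T) = \<phi> t + 2 * pi"
proof -
  have M: "M > 0" using pos[of 0] bnd[of 0] by linarith
  have "continuous_on UNIV (\<lambda>\<theta>. 1 / w \<theta>)"
    by (intro continuous_intros cont) (metis pos less_irrefl)
  from continuous_antiderivative_UNIV[OF this]
  obtain G where G: "\<And>x. (G has_real_derivative 1 / w x) (at x)" by blast
  have strict: "G x < G y" if "x < y" for x y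
    using that
  proof (rule DERIV_pos_imp_increasing)
    show "\<exists>d. (G has_real_derivative d) (at s) \<and> 0 < d" for s
      using G[of s] pos[of s] by (intro exI[of _ "1 / w s"]) simp
  qed
  \<comment> \<open>\<open>G\<close> grows at least as fast as \<open>x / M\<close>, so it is
    unbounded in both directions and hence onto.\<close>
  have growth: "(y - x) / M \<le> G y - G x" if "x \<le> y" for x y
  proof -
    have "G x - x / M \<le> G y - y / M"
    proof (rule DERIV_nonneg_imp_nondecreasing[OF that])
      fix s
      have "((\<lambda>s. G s - s / M) has_real_derivative 1 / w s - 1 / M) (at s)"
        using M by (auto intro!: derivative_eq_intros G)
      moreover have "1 / w s - 1 / M \<ge> 0"
        using pos[of s] bnd[of s] M by (simp add: frac_le)
      ultimately show "\<exists>d. ((\<lambda>s. G s - s / M) has_real_derivative d) (at s) \<and> 0 \<le> d" by blast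
    qed
    then show ?thesis by (simp add: diff_divide_distrib)
  qed
  have contG: "isCont G x" for x using G DERIV_isCont by blast
  have surj: "\<exists>x. G x = t" for t
  proof -
    define X where "X = M * \<bar>t - G 0\<bar>"
    have X: "X \<ge> 0" "X / M = \<bar>t - G 0\<bar>" using M by (auto simp: X_def)
    have "G (-X) \<le> t" "t \<le> G X" using growth[of "-X" 0] growth[of 0 X] X by auto
    then show ?thesis using IVT[of G "-X" t X] contG X by auto
  qed
  have inj: "inj G" using strict by (metis injI less_irrefl linorder_neqE_linordered_idom)
  define K where "K = inv G"
  have GK: "G (K t) = t" for t using surj by (metis K_def f_inv_into_f rangeI)
  have KG: "K (G x) = x" for x using inj by (simp add: K_def)
  have dK: "(K has_real_derivative w (K t)) (at t)" for t
  proof -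
    have "isCont K (G (K t))"
      by (rule isCont_inverse_function2[where a="K t - 1" and b="K t + 1"]) (auto simp: KG contG)
    then have "DERIV K t :> inverse (1 / w (K t))"
      by (intro DERIV_inverse_function[where f=G and a="t - 1" and b="t + 1"])
        (use G GK pos in \<open>auto simp: less_imp_neq[symmetric]\<close>)
    then show ?thesis by simp
  qed
  \<comment> \<open>The duration of the turn from \<open>0\<close> to \<open>2 * pi\<close>. A turn
    from any other angle takes as long, because \<open>G (x + 2 * pi) - G x\<close> has derivative
    zero.\<close>
  define T where "T = G (2 * pi) - G 0"
  have shift: "G (x + 2 * pi) = G x + T" for x
  proof -
    have "((\<lambda>x. G (x + 2 * pi) - G x) has_real_derivative 0) (at x)" for x
    proof -
      have "((\<lambda>x. G (x + 2 * pi)) has_real_derivative 1 / w x) (at x)"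
        using G[of "x + 2 * pi"] per[of x] by (simp add: DERIV_shift)
      from DERIV_diff[OF this G[of x]] show ?thesis by simp
    qed
    then have "(\<lambda>x. G (x + 2 * pi) - G x) x = (\<lambda>x. G (x + 2 * pi) - G x) 0"
      by (intro DERIV_isconst_all) auto
    then show ?thesis by (simp add: T_def)
  qed
  define \<phi> where "\<phi> t = K (t + G \<theta>0)" for t
  show thesis
  proof
    show "T > 0" using strict[of 0 "2 * pi"] by (simp add: T_def)
    show "\<phi> 0 = \<theta>0" by (simp add: \<phi>_def KG)
    show "(\<phi> has_real_derivative w (\<phi> t)) (at t)" for t
      using dK[of "t + G \<theta>0"] unfolding \<phi>_def by (simp add: DERIV_shift)
    show "\<phi> (t + T) = \<phi> t + 2 * pi" for t
      using shift[of "\<phi> t"] by (metis (no_types, opaque_lifting) GK KG \<phi>_def add.assoc add.commute)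
  qed
qed

section \<open>Lyapunov functions and the exclusion of centers\<close>

text \<open>A curve leaving the ball has a first time on the sphere of radius \<open>r\<close>.
  Until then it stays in the closed ball, where \<open>L\<close> cannot increase, yet on the sphere
  \<open>L\<close> exceeds its starting value.\<close>

lemma trapped_below_sphere:
  fixes z :: "real \<Rightarrow> 'a::metric_space"
  assumes cont: "continuous_on {0..} z" and start: "z 0 \<in> ball p r"
    and level: "\<And>w. dist p w = r \<Longrightarrow> L (z 0) < L w"
    and der: "\<And>t. 0 \<le> t \<Longrightarrow> z t \<in> cball p r \<Longrightarrow>
      \<exists>d. ((\<lambda>t. L (z t)) has_real_derivative d) (at t) \<and> d \<le> 0"
    and t: "0 \<le> t"
  shows "z t \<in> ball p r"
proof (rule ccontr)
  assume out: "z t \<notin> ball p r"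
  define f where "f s = dist p (z s)" for s
  have contf: "continuous_on {0..} f" unfolding f_def by (intro continuous_intros cont)
  define S where "S = {s \<in> {0..t}. f s = r}"
  have hit: "\<exists>s'. 0 \<le> s' \<and> s' \<le> s \<and> f s' = r" if "0 \<le> s" "r \<le> f s" for s
    using that start by (intro IVT') (auto simp: f_def intro: continuous_on_subset[OF contf[unfolded f_def]])
  have "compact S"
  proof -
    have "closed S" unfolding S_def
      by (intro continuous_closed_preimage_constant continuous_on_subset[OF contf]) auto
    moreover have "bounded S"
      by (rule bounded_subset[of "{0..t}"]) (simp_all add: S_def Collect_mono_iff subset_iff)
    ultimately show ?thesis unfolding compact_eq_bounded_closed by (rule conjI[rotated])
  qed
  moreover have "S \<noteq> {}"
  proof -
    have "r \<le> f t" using out by (simp add: f_def)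
    from hit[OF t this] show ?thesis by (auto simp: S_def)
  qed
  ultimately have "\<exists>s0\<in>S. \<forall>s\<in>S. s0 \<le> s" by (rule compact_attains_inf)
  then obtain s0 where s0: "s0 \<in> S" and least: "\<And>s. s \<in> S \<Longrightarrow> s0 \<le> s" by blast
  \<comment> \<open>By the intermediate value theorem an excursion beyond radius \<open>r\<close>
    would put a strictly earlier time into \<open>S\<close>.\<close>
  have below: "f s \<le> r" if s: "0 \<le> s" "s \<le> s0" for s
  proof (rule ccontr)
    assume "\<not> f s \<le> r"
    then obtain s' where s': "0 \<le> s'" "s' \<le> s" "f s' = r" using hit[OF s(1)] by auto
    then have "s' \<in> S" using s s0 by (auto simp: S_def)
    then have "s0 \<le> s'" by (rule least)
    then have "s' = s" using s' s by linarith
    then show False using s' \<open>\<not> f s \<le> r\<close> by simp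
  qed
  have "L (z s0) \<le> L (z 0)"
    by (rule DERIV_nonpos_imp_nonincreasing[of 0 s0 "\<lambda>t. L (z t)"])
      (use s0 below der in \<open>auto simp: S_def f_def\<close>)
  moreover have "L (z 0) < L (z s0)" using s0 by (intro level) (auto simp: S_def f_def)
  ultimately show False by simp
qed

lemma periodic_nat_shift:
  fixes z :: "real \<Rightarrow> 'a"
  assumes "\<And>t. z (t + T) = z t"
  shows "z (t + of_nat n * T) = z t"
proof (induction n)
  case (Suc n)
  have "t + of_nat (Suc n) * T = t + of_nat n * T + T" by (simp add: algebra_simps)
  then show ?case by (metis Suc.IH assms)
qed simp

text \<open>LaSalle's principle: on a periodic orbit inside the ball, a monotone function is constant.\<close>

lemma not_center_if_Lyapunov:
  fixes F :: "real \<times> real \<Rightarrow> real \<times> real" and L l :: "real \<times> real \<Rightarrow> real"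
  assumes r: "0 < r" and contL: "continuous_on (cball p r) L"
    and pos: "\<And>w. w \<in> cball p r \<Longrightarrow> w \<noteq> p \<Longrightarrow> L p < L w"
    and der: "\<And>z t. (z has_vector_derivative F (z t)) (at t) \<Longrightarrow> z t \<in> cball p r \<Longrightarrow>
      ((\<lambda>t. L (z t)) has_real_derivative l (z t)) (at t)"
    and sign: "(\<forall>w \<in> cball p r. l w \<le> 0) \<or> (\<forall>w \<in> cball p r. 0 \<le> l w)"
    and inv: "\<And>z. (\<And>t. (z has_vector_derivative F (z t)) (at t)) \<Longrightarrow> (\<And>t. z t \<in> cball p r) \<Longrightarrow>
      (\<And>t. l (z t) = 0) \<Longrightarrow> \<exists>t. z t = p"
  shows "\<not> is_center F p"
proof
  assume "is_center F p"
  then obtain U where U: "open U" "p \<in> U"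
    and per: "\<And>q. q \<in> U - {p} \<Longrightarrow> periodic_orbit_in F q (U - {p})"
    unfolding is_center_def by auto
  have "compact (sphere p r)" "sphere p r \<noteq> {}" using r by auto
  moreover have "continuous_on (sphere p r) L" by (rule continuous_on_subset[OF contL]) auto
  \<comment> \<open>The minimum of \<open>L\<close> on the sphere exceeds \<open>L p\<close>, so a
    starting point \<open>q\<close> close to \<open>p\<close> lies below the level of the whole
    sphere.\<close>
  ultimately obtain w0 where w0: "w0 \<in> sphere p r" "\<And>w. w \<in> sphere p r \<Longrightarrow> L w0 \<le> L w"
    using continuous_attains_inf by metis
  have "L p < L w0" using w0 r by (intro pos) auto
  moreover have "isCont L p"
    using contL r by (auto intro!: continuous_on_interior[of "cball p r"])
  ultimately have "\<forall>\<^sub>F q in at p. L q < L w0"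
    by (metis isContD order_tendstoD(2))
  moreover have "\<forall>\<^sub>F q in at p. q \<in> U \<inter> ball p r - {p}"
    using U r by (intro eventually_at_in_open) auto
  ultimately have "\<forall>\<^sub>F q in at p. L q < L w0 \<and> q \<in> U \<inter> ball p r - {p}"
    by (rule eventually_conj)
  then obtain q where q: "L q < L w0" "q \<in> U" "q \<in> ball p r" "q \<noteq> p"
    by (force dest!: eventually_happens'[OF at_neq_bot])
  then obtain z T where T: "T > 0" and z0: "z 0 = q"
    and sol: "\<And>t. (z has_vector_derivative F (z t)) (at t)"
    and perz: "\<And>t. z (t + T) = z t" and zU: "\<And>t. z t \<in> U - {p}"
    using per[of q] unfolding periodic_orbit_in_def by auto
  have contz: "isCont z t" for t
    using sol has_vector_derivative_continuous by blast
  have shift: "z (t + of_nat n * T) = z t" for t n by (rule periodic_nat_shift) (rule perz)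
  have level: "dist p w = r \<Longrightarrow> L q < L w" for w using w0(2)[of w] q(1) by force
  have inball: "z t \<in> cball p r" for t
  proof -
    \<comment> \<open>Adding or subtracting \<open>n\<close> periods makes the time positive or
      negative, so trapping in one time direction confines the whole orbit.\<close>
    obtain n where n: "\<bar>t\<bar> < of_nat n * T" using reals_Archimedean3[OF T] by blast
    from sign show ?thesis
    proof
      assume neg: "\<forall>w \<in> cball p r. l w \<le> 0"
      have "z (t + of_nat n * T) \<in> ball p r"
      proof (rule trapped_below_sphere[where L=L])
        show "continuous_on {0..} z" by (intro continuous_at_imp_continuous_on) (auto intro: contz)
        show "\<exists>d. ((\<lambda>t. L (z t)) has_real_derivative d) (at t) \<and> d \<le> 0" if "z t \<in> cball p r" for t
          using der[OF sol that] neg that by blast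
      qed (use n z0 q level in auto)
      then show ?thesis by (simp add: shift)
    next
      assume nonneg: "\<forall>w \<in> cball p r. 0 \<le> l w"
      \<comment> \<open>For nondecreasing \<open>L\<close> the trapping argument is applied to the
        time-reversed curve.\<close>
      have "z (- (of_nat n * T - t)) \<in> ball p r"
      proof (rule trapped_below_sphere[where L=L and z="\<lambda>t. z (-t)"])
        show "continuous_on {0..} (\<lambda>t. z (- t))"
          by (intro continuous_at_imp_continuous_on ballI isCont_o2[OF _ contz]) auto
        fix t
        assume "z (-t) \<in> cball p r"
        from der[OF sol this]
        have "((\<lambda>t. L (z (- t))) has_real_derivative - l (z (-t))) (at t)"
          by (simp add: DERIV_mirror)
        then show "\<exists>d. ((\<lambda>t. L (z (- t))) has_real_derivative d) (at t) \<and> d \<le> 0"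
          using nonneg \<open>z (-t) \<in> cball p r\<close> by (intro exI[of _ "- l (z (-t))"]) auto
      qed (use n z0 q level in auto)
      then show ?thesis using shift[of "t - of_nat n * T" n] by simp
    qed
  qed
  define f where "f t = L (z t)" for t
  have df: "(f has_real_derivative l (z t)) (at t)" for t
    unfolding f_def by (rule der[OF sol inball])
  have perf: "f (t + of_nat n * T) = f t" for t n by (simp add: f_def shift)
  \<comment> \<open>A monotone periodic function is constant: \<open>f t\<close> lies between
    \<open>f s\<close> and the value of \<open>f\<close> whole periods later, which is again
    \<open>f s\<close>.\<close>
  have "f s = f t" if "s \<le> t" for s t
  proof -
    obtain n where n: "t - s < of_nat n * T" using reals_Archimedean3[OF T] by blast
    from sign show ?thesis
    proof
      assume "\<forall>w \<in> cball p r. l w \<le> 0"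
      then have "antimono f"
        unfolding monotone_def using df inball DERIV_nonpos_imp_nonincreasing[of _ _ f] by blast
      then have "f t \<le> f s" "f (s + of_nat n * T) \<le> f t"
        using n that by (simp_all add: antimonoD)
      then show ?thesis unfolding perf by simp
    next
      assume "\<forall>w \<in> cball p r. 0 \<le> l w"
      then have "mono f"
        unfolding monotone_def using df inball DERIV_nonneg_imp_nondecreasing[of _ _ f] by blast
      then have "f s \<le> f t" "f t \<le> f (s + of_nat n * T)"
        using n that by (simp_all add: monoD)
      then show ?thesis unfolding perf by simp
    qed
  qed
  then have "f = (\<lambda>t. f 0)" by (metis linorder_le_cases)
  then have "l (z t) = 0" for t using df[of t] by (metis DERIV_const DERIV_unique)
  then have "\<exists>t. z t = p" using inv sol inball by blast
  then show False using zU by auto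
qed

section \<open>Building centers from rotations\<close>

text \<open>The equations \<open>Y' = \<omega> * S\<close>, \<open>S' = - \<omega> * Y\<close>
  preserve each circle about the origin, so only the angle has to be found, and
  \<open>circle_rotation_flow\<close> supplies it. \<open>\<Gamma>\<close> carries these periodic
  motions to \<open>F\<close>, and the image of the ball is the neighbourhood required by
  \<open>is_center\<close>.\<close>

lemma is_center_if_conjugate_to_rotation:
  fixes F \<Gamma> :: "real \<times> real \<Rightarrow> real \<times> real" and \<omega> :: "real \<times> real \<Rightarrow> real"
  assumes R: "R > 0"
    and cont: "continuous_on (ball 0 R) \<Gamma>" and inj: "inj_on \<Gamma> (ball 0 R)"
    and cont\<omega>: "continuous_on (ball 0 R) \<omega>" and pos: "\<And>q. q \<in> ball 0 R \<Longrightarrow> 0 < \<omega> q"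
    and conj: "\<And>Y S t. (Y has_real_derivative \<omega> (Y t, S t) * S t) (at t) \<Longrightarrow>
      (S has_real_derivative - (\<omega> (Y t, S t) * Y t)) (at t) \<Longrightarrow> (Y t, S t) \<in> ball 0 R \<Longrightarrow>
      ((\<lambda>t. \<Gamma> (Y t, S t)) has_vector_derivative F (\<Gamma> (Y t, S t))) (at t)"
    and zero: "F (\<Gamma> 0) = 0" and nz: "\<And>q. q \<in> ball 0 R \<Longrightarrow> q \<noteq> 0 \<Longrightarrow> F (\<Gamma> q) \<noteq> 0"
  shows "is_center F (\<Gamma> 0)"
  unfolding is_center_def
proof (intro conjI exI ballI)
  let ?U = "\<Gamma> ` ball 0 R"
  show "F (\<Gamma> 0) = 0" by (rule zero)
  \<comment> \<open>A continuous injection of the plane disc has open image and is a homeomorphism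
    onto it, so the image inherits simple connectedness.\<close>
  show "open ?U" by (intro invariance_of_domain cont inj) auto
  show "\<Gamma> 0 \<in> ?U" using R by auto
  obtain g where "homeomorphism (ball 0 R) ?U \<Gamma> g"
    using invariance_of_domain_homeomorphism[OF open_ball cont order_refl inj] .
  then have "ball (0 :: real \<times> real) R homeomorphic ?U" unfolding homeomorphic_def by blast
  then show "simply_connected ?U"
    using convex_imp_simply_connected homeomorphic_simply_connected_eq convex_ball by metis
  fix c assume "c \<in> ?U - {\<Gamma> 0}"
  then obtain q where q: "q \<in> ball 0 R" "q \<noteq> 0" "c = \<Gamma> q" by blast
  then show "F c \<noteq> 0" using nz by auto
  define r where "r = norm q"
  have r: "0 < r" "r < R" using q by (auto simp: r_def)
  have "(fst q)\<^sup>2 + (snd q)\<^sup>2 = r\<^sup>2" by (cases q) (simp add: r_def norm_Pair)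
  then have "(snd q / r)\<^sup>2 + (fst q / r)\<^sup>2 = 1"
    using r by (simp add: power_divide flip: add_divide_distrib)
  then obtain \<theta>0 where "snd q / r = cos \<theta>0" "fst q / r = sin \<theta>0"
    by (rule sincos_total_2pi)
  then have \<theta>0: "q = (r * sin \<theta>0, r * cos \<theta>0)"
    using r by (cases q) (simp add: field_simps)
  \<comment> \<open>With the sine first, the equations for \<open>Y\<close> and \<open>S\<close> say
    that the angle increases at rate \<open>\<omega>\<close>.\<close>
  define C where "C \<theta> = (r * sin \<theta>, r * cos \<theta>)" for \<theta>
  have normC: "norm (C \<theta>) = r" for \<theta>
    using r by (simp add: C_def norm_Pair power_mult_distrib flip: distrib_left)
  then have C: "C \<theta> \<in> ball 0 R" for \<theta> using r by simp
  have contC: "continuous_on A C" for A unfolding C_def by (intro continuous_intros)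
  have "continuous_on (sphere 0 r) \<omega>"
    by (rule continuous_on_subset[OF cont\<omega>]) (use r in auto)
  then have "\<exists>w\<in>sphere 0 r. \<forall>y\<in>sphere 0 r. \<omega> y \<le> \<omega> w"
    using r by (intro continuous_attains_sup) auto
  then obtain M where M: "\<And>w. w \<in> sphere 0 r \<Longrightarrow> \<omega> w \<le> M" by blast
  obtain \<phi> T where T: "T > 0" and \<phi>0: "\<phi> 0 = \<theta>0"
    and \<phi>: "\<And>t. (\<phi> has_real_derivative \<omega> (C (\<phi> t))) (at t)"
    and per: "\<And>t. \<phi> (t + T) = \<phi> t + 2 * pi"
  proof (rule circle_rotation_flow[of "\<lambda>\<theta>. \<omega> (C \<theta>)" M \<theta>0])
    show "continuous_on UNIV (\<lambda>\<theta>. \<omega> (C \<theta>))"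
      by (rule continuous_on_compose2[OF cont\<omega> contC]) (use C in auto)
    show "\<omega> (C (\<theta> + 2 * pi)) = \<omega> (C \<theta>)" for \<theta> by (simp add: C_def)
  qed (use M normC pos C in auto)
  have cq: "C (\<phi> 0) = q" by (simp add: \<phi>0 \<theta>0 C_def)
  have "((\<lambda>t. \<Gamma> (C (\<phi> t))) has_vector_derivative F (\<Gamma> (C (\<phi> t)))) (at t)" for t
    unfolding C_def
  proof (rule conj)
    show "((\<lambda>t. r * sin (\<phi> t)) has_real_derivative
        \<omega> (r * sin (\<phi> t), r * cos (\<phi> t)) * (r * cos (\<phi> t))) (at t)"
      using \<phi>[of t] unfolding C_def by (auto intro!: derivative_eq_intros)
    show "((\<lambda>t. r * cos (\<phi> t)) has_real_derivative
        - (\<omega> (r * sin (\<phi> t), r * cos (\<phi> t)) * (r * sin (\<phi> t)))) (at t)"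
      using \<phi>[of t] unfolding C_def by (auto intro!: derivative_eq_intros)
    show "(r * sin (\<phi> t), r * cos (\<phi> t)) \<in> ball 0 R" using C unfolding C_def .
  qed
  moreover have "\<Gamma> (C (\<phi> (t + T))) = \<Gamma> (C (\<phi> t))" for t
    unfolding per by (simp add: C_def)
  moreover have "\<Gamma> (C (\<phi> t)) \<in> ?U - {\<Gamma> 0}" for t
  proof -
    have "C (\<phi> t) \<noteq> 0" using normC[of "\<phi> t"] r by auto
    then show ?thesis using inj_onD[OF inj, of "C (\<phi> t)" 0] C R by auto
  qed
  ultimately show "periodic_orbit_in F c (?U - {\<Gamma> 0})"
    unfolding periodic_orbit_in_def using T cq q(3)
    by (intro exI[of _ "\<lambda>t. \<Gamma> (C (\<phi> t))"] exI[of _ T]) auto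
qed

text \<open>Straightens the separable first integral: \<open>\<alpha>\<close> is the inverse of
  \<open>y \<mapsto> sgn y * sqrt (2 * A y)\<close> with \<open>A' = h\<close>, so that \<open>A (\<alpha> Y) = Y\<^sup>2 / 2\<close>.\<close>

lemma straightening_coordinate:
  fixes h :: "real \<Rightarrow> real"
  assumes \<delta>: "0 < \<delta>" and cont: "continuous_on {-\<delta>..\<delta>} h" and h0: "h 0 = 0"
    and der: "(h has_real_derivative h1) (at 0)" and h1: "0 < h1"
  obtains R \<alpha> \<alpha>' where "0 < R" "\<alpha> 0 = 0" "continuous_on {-R<..<R} \<alpha>'"
    "\<And>Y. \<bar>Y\<bar> < R \<Longrightarrow> \<bar>\<alpha> Y\<bar> < \<delta>" "\<And>Y. \<bar>Y\<bar> < R \<Longrightarrow> 0 < \<alpha>' Y"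
    "\<And>Y. \<bar>Y\<bar> < R \<Longrightarrow> (\<alpha> has_real_derivative \<alpha>' Y) (at Y)"
    "\<And>Y. \<bar>Y\<bar> < R \<Longrightarrow> h (\<alpha> Y) * \<alpha>' Y = Y"
proof -
  have hlim: "(\<lambda>y. h y / y) \<midarrow>0\<rightarrow> h1"
    using der by (simp add: DERIV_def h0)
  then have "\<forall>\<^sub>F y in at 0. 0 < h y / y" using h1 by (rule order_tendstoD)
  then obtain d where d: "0 < d" "\<And>y. y \<noteq> 0 \<Longrightarrow> \<bar>y\<bar> < d \<Longrightarrow> 0 < h y / y"
    by (auto simp: eventually_at dist_real_def)
  define e where "e = min d \<delta>"
  have e: "0 < e" "e \<le> \<delta>" using d \<delta> by (auto simp: e_def)
  have hpos: "0 < h y / y" if "y \<noteq> 0" "\<bar>y\<bar> < e" for y using d that by (auto simp: e_def)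
  obtain A0 where A0: "\<And>x. x \<in> {-\<delta>..\<delta>} \<Longrightarrow>
      (A0 has_vector_derivative h x) (at x within {-\<delta>..\<delta>})"
    using antiderivative_continuous[OF cont] by metis
  define A where "A y = A0 y - A0 0" for y
  have A00: "A 0 = 0" by (simp add: A_def)
  have dA: "(A has_real_derivative h y) (at y)" if "\<bar>y\<bar> < e" for y
  proof -
    have y: "y \<in> {-\<delta>..\<delta>}" "y \<in> {-\<delta><..<\<delta>}" using that e by auto
    then have "at y within {-\<delta>..\<delta>} = at y" by (intro at_within_interior) auto
    then have "(A0 has_real_derivative h y) (at y)"
      using A0[OF y(1)] by (simp add: has_real_derivative_iff_has_vector_derivative)
    then show ?thesis unfolding A_def by (auto intro!: derivative_eq_intros)
  qed
  have Apos: "0 < A y" if y: "y \<noteq> 0" "\<bar>y\<bar> < e" for y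
  proof (cases "0 < y")
    case True
    then obtain \<xi> where "0 < \<xi>" "\<xi> < y" "A y - A 0 = (y - 0) * h \<xi>"
      using MVT2[of 0 y A h] dA y by (auto simp: abs_less_iff)
    then show ?thesis using hpos[of \<xi>] y True by (simp add: A00 zero_less_divide_iff)
  next
    case False
    then have neg: "y < 0" using y by simp
    then obtain \<xi> where "y < \<xi>" "\<xi> < 0" "A 0 - A y = (0 - y) * h \<xi>"
      using MVT2[of y 0 A h] dA y by (auto simp: abs_less_iff)
    then show ?thesis using hpos[of \<xi>] y neg
      by (auto simp: A00 zero_less_divide_iff mult_neg_neg)
  qed
  \<comment> \<open>\<open>q\<close> is \<open>2 * A y / y\<^sup>2\<close> extended by its limit
    \<open>h1\<close>, so that \<open>f\<close> is the signed root of \<open>2 * A\<close> in a form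
    that can be differentiated at \<open>0\<close>. \<open>D\<close> is its derivative:
    \<open>f\<^sup>2 / 2 = A\<close> gives \<open>f * f' = h\<close>.\<close>
  define q where "q y = (if y = 0 then h1 else 2 * A y / y\<^sup>2)" for y
  define f where "f y = y * sqrt (q y)" for y
  define D where "D y = (if y = 0 then sqrt h1 else h y / f y)" for y
  have qpos: "0 < q y" if "\<bar>y\<bar> < e" for y using Apos that h1 by (simp add: q_def)
  have near: "\<forall>\<^sub>F y in at 0. y \<noteq> 0 \<and> \<bar>y\<bar> < e"
    using e by (auto simp: eventually_at dist_real_def)
  have qlim: "q \<midarrow>0\<rightarrow> h1"
  proof -
    have "(\<lambda>y. A y / y\<^sup>2) \<midarrow>0\<rightarrow> h1 / 2"
    proof (rule lhopital[where f'=h and g'="\<lambda>y. 2 * y"])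
      show "A \<midarrow>0\<rightarrow> 0" using DERIV_isCont[OF dA[of 0]] e A00 by (simp add: isCont_def)
      show "(\<lambda>y::real. y\<^sup>2) \<midarrow>0\<rightarrow> 0" by (auto intro!: tendsto_eq_intros)
      show "\<forall>\<^sub>F y in at 0. (A has_real_derivative h y) (at y)"
        using near by eventually_elim (use dA in auto)
      show "\<forall>\<^sub>F y in at (0::real). y\<^sup>2 \<noteq> 0" "\<forall>\<^sub>F y in at (0::real). 2 * y \<noteq> 0"
        using near by (eventually_elim, simp)+
      show "\<forall>\<^sub>F y in at (0::real). ((\<lambda>y. y\<^sup>2) has_real_derivative 2 * y) (at y)"
        by (auto intro!: always_eventually derivative_eq_intros)
      have "(\<lambda>y. h y / y / 2) \<midarrow>0\<rightarrow> h1 / 2" by (intro tendsto_divide hlim) auto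
      then show "(\<lambda>y. h y / (2 * y)) \<midarrow>0\<rightarrow> h1 / 2" by (simp add: mult.commute)
    qed
    from tendsto_mult[OF tendsto_const this, of 2]
    have "(\<lambda>y. 2 * (A y / y\<^sup>2)) \<midarrow>0\<rightarrow> h1" by simp
    moreover have "\<forall>\<^sub>F y in at 0. 2 * (A y / y\<^sup>2) = q y"
      using near by eventually_elim (simp add: q_def)
    ultimately show ?thesis by (rule Lim_transform_eventually)
  qed
  have fsq: "f y = (if 0 < y then sqrt (2 * A y) else - sqrt (2 * A y))"
    if "y \<noteq> 0" "\<bar>y\<bar> < e" for y
    using that Apos[OF that] by (auto simp: f_def q_def real_sqrt_divide)
  have df: "(f has_real_derivative D y) (at y)" if y: "\<bar>y\<bar> < e" for y
  proof (cases "y = 0")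
    case True
    have "(\<lambda>y. sqrt (q y)) \<midarrow>0\<rightarrow> sqrt h1" by (intro tendsto_real_sqrt qlim)
    moreover have "\<forall>\<^sub>F y in at 0. sqrt (q y) = f y / y"
      using near by eventually_elim (simp add: f_def)
    ultimately have "(\<lambda>y. f y / y) \<midarrow>0\<rightarrow> sqrt h1" by (rule Lim_transform_eventually)
    then show ?thesis using True by (simp add: DERIV_def D_def f_def)
  next
    case False
    \<comment> \<open>On \<open>N\<close> the sign of the argument is constant, and \<open>f\<close>
      is \<open>s * sqrt (2 * A x)\<close>.\<close>
    define s :: real where "s = (if 0 < y then 1 else - 1)"
    define N where "N = {x. x \<noteq> 0 \<and> \<bar>x\<bar> < e \<and> 0 < s * x}"
    have "((\<lambda>x. s * sqrt (2 * A x)) has_real_derivative D y) (at y)"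
      using False y Apos[of y] fsq[of y] dA[OF y]
      by (auto intro!: derivative_eq_intros simp: D_def s_def divide_simps)
    moreover have "open N"
    proof -
      have "N = {x. 0 < s * x} \<inter> {x. \<bar>x\<bar> < e}" by (auto simp: N_def)
      then show ?thesis by (auto intro!: open_Int open_Collect_less continuous_intros)
    qed
    moreover have "y \<in> N" using False y by (auto simp: N_def s_def)
    moreover have "s * sqrt (2 * A x) = f x" if "x \<in> N" for x
      using that fsq[of x] by (auto simp: N_def s_def split: if_splits)
    ultimately show ?thesis by (rule has_field_derivative_transform_within_open)
  qed
  have Dpos: "0 < D y" if y: "\<bar>y\<bar> < e" for y
  proof (cases "y = 0")
    case False
    have "D y = (h y / y) / sqrt (q y)" using False by (simp add: D_def f_def)
    moreover have "0 < (h y / y) / sqrt (q y)"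
      by (rule divide_pos_pos[OF hpos[OF False y]]) (simp add: qpos[OF y])
    ultimately show ?thesis by (simp only:)
  qed (simp add: D_def h1)
  have fD: "f y * D y = h y" if "\<bar>y\<bar> < e" for y
    using qpos[OF that] by (auto simp: D_def f_def h0)
  have contD: "isCont D y" if y: "\<bar>y\<bar> < e" for y
  proof (cases "y = 0")
    case True
    have "(\<lambda>y. (h y / y) / sqrt (q y)) \<midarrow>0\<rightarrow> h1 / sqrt h1"
      using h1 by (intro tendsto_divide hlim tendsto_real_sqrt qlim) auto
    moreover have "\<forall>\<^sub>F y in at 0. (h y / y) / sqrt (q y) = D y"
      using near by eventually_elim (simp add: f_def D_def)
    ultimately have "D \<midarrow>0\<rightarrow> h1 / sqrt h1" by (rule Lim_transform_eventually)
    then show ?thesis using True h1 by (simp add: isCont_def D_def real_div_sqrt)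
  next
    case False
    have "isCont h y"
      using y e by (intro continuous_on_interior[OF cont]) auto
    moreover have "f y \<noteq> 0" using False qpos[OF y] by (simp add: f_def)
    ultimately have "isCont (\<lambda>x. h x / f x) y"
      using DERIV_isCont[OF df[OF y]] by (intro continuous_intros) auto
    moreover have "\<forall>\<^sub>F x in nhds y. h x / f x = D x"
      using t1_space_nhds[OF False] by eventually_elim (simp add: D_def)
    ultimately show ?thesis by (simp add: isCont_cong)
  qed
  have mono: "f x < f y" if "-e < x" "x < y" "y < e" for x y
    using that(2)
  proof (rule DERIV_pos_imp_increasing)
    show "\<exists>d. (f has_real_derivative d) (at s) \<and> 0 < d" if s: "x \<le> s" "s \<le> y" for s
    proof -
      have "\<bar>s\<bar> < e" using s \<open>-e < x\<close> \<open>y < e\<close> by linarith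
      then show ?thesis using df Dpos by blast
    qed
  qed
  define c where "c = e / 2"
  have c: "0 < c" "c < e" using e by (auto simp: c_def)
  define I where "I = {-c..c}"
  have injf: "inj_on f I"
  proof (rule linorder_inj_onI')
    show "f x \<noteq> f y" if "x \<in> I" "y \<in> I" "x < y" for x y
      using mono[of x y] that c by (simp add: I_def)
  qed
  define \<alpha> where "\<alpha> = inv_into I f"
  have f0: "f 0 = 0" by (simp add: f_def)
  \<comment> \<open>With this \<open>R\<close>, each \<open>Y\<close> with
    \<open>\<bar>Y\<bar> < R\<close> lies strictly between \<open>f (- c)\<close> and
    \<open>f c\<close> and has a preimage inside \<open>I\<close>.\<close>
  define R where "R = min (f c) (- f (- c))"
  have R: "0 < R" using mono[of 0 c] mono[of "-c" 0] c f0 by (auto simp: R_def)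
  have \<alpha>f: "\<alpha> (f y) = y" if "y \<in> I" for y using injf that by (simp add: \<alpha>_def)
  have inv: "\<bar>\<alpha> Y\<bar> < c \<and> f (\<alpha> Y) = Y" if Y: "\<bar>Y\<bar> < R" for Y
  proof -
    have "\<exists>y\<ge>-c. y \<le> c \<and> f y = Y"
    proof (rule IVT')
      show "continuous_on {-c..c} f"
        using c by (intro continuous_at_imp_continuous_on ballI DERIV_isCont[OF df]) auto
    qed (use Y c in \<open>auto simp: R_def\<close>)
    then obtain y where y: "y \<in> I" "f y = Y" by (auto simp: I_def)
    then have "\<alpha> Y = y" using \<alpha>f by blast
    moreover have "y \<noteq> c" "y \<noteq> - c" using y Y by (auto simp: R_def)
    ultimately show ?thesis using y by (auto simp: I_def)
  qed
  have d\<alpha>: "(\<alpha> has_real_derivative inverse (D (\<alpha> Y))) (at Y)" if Y: "\<bar>Y\<bar> < R" for Y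
  proof (rule DERIV_inverse_function[where f=f and a="-R" and b=R])
    have a: "\<bar>\<alpha> Y\<bar> < c" "f (\<alpha> Y) = Y" using inv[OF Y] by auto
    show "(f has_real_derivative D (\<alpha> Y)) (at (\<alpha> Y))" using a c by (intro df) auto
    show "D (\<alpha> Y) \<noteq> 0" using a c Dpos[of "\<alpha> Y"] by auto
    have "isCont \<alpha> (f (\<alpha> Y))"
    proof (rule isCont_inverse_function2[where f=f and x="\<alpha> Y" and a="-c" and b=c])
      show "isCont f z" if "-c \<le> z" "z \<le> c" for z
        using that c by (intro DERIV_isCont[OF df]) auto
    qed (use a \<alpha>f in \<open>auto simp: I_def\<close>)
    then show "isCont \<alpha> Y" by (simp add: a)
  qed (use Y inv in auto)
  show thesis
  proof
    show "0 < R" by (rule R)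
    show "\<alpha> 0 = 0" using \<alpha>f[of 0] c by (simp add: I_def f0)
    show "continuous_on {-R<..<R} (\<lambda>Y. inverse (D (\<alpha> Y)))"
    proof (intro continuous_at_imp_continuous_on ballI)
      fix Y assume "Y \<in> {-R<..<R}"
      then have Y: "\<bar>Y\<bar> < R" by auto
      have a: "\<bar>\<alpha> Y\<bar> < e" using inv[OF Y] c by auto
      have "isCont (\<lambda>Y. D (\<alpha> Y)) Y"
        by (rule isCont_o2[OF DERIV_isCont[OF d\<alpha>[OF Y]] contD[OF a]])
      then show "isCont (\<lambda>Y. inverse (D (\<alpha> Y))) Y"
        using Dpos[OF a] by (intro continuous_intros) auto
    qed
    fix Y assume Y: "\<bar>Y\<bar> < R"
    then have a: "\<bar>\<alpha> Y\<bar> < e" "\<bar>\<alpha> Y\<bar> < \<delta>" "f (\<alpha> Y) = Y" using inv[OF Y] c e by auto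
    show "\<bar>\<alpha> Y\<bar> < \<delta>" by (rule a)
    show "0 < inverse (D (\<alpha> Y))" using Dpos[OF a(1)] by simp
    show "(\<alpha> has_real_derivative inverse (D (\<alpha> Y))) (at Y)" by (rule d\<alpha>[OF Y])
    show "h (\<alpha> Y) * inverse (D (\<alpha> Y)) = Y"
      using fD[OF a(1)] Dpos[OF a(1)] a(3) by (simp add: divide_simps)
  qed
qed

section \<open>The cubic family and its Lienard form\<close>

text \<open>The smallness of the parameters enters through these two inequalities. The second
  quantity is half the determinant of the linearization at \<open>(1, 0)\<close> and
  \<open>(-1, 0)\<close>.\<close>

locale reversible_cubic =
  fixes a20 a21 a01 a02 a03 b30 b11 b12 :: real
  assumes b30: "b30 < 1"
    and det: "0 < (1 - b30) * (1 + a01 + a21) + a20 * b11"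
begin

abbreviation F where "F \<equiv> sysF a20 a21 a01 a02 a03 b30 b11 b12"

definition "b = 1 - b30"
text \<open>\<open>g1\<close> is the determinant of the linearization at the singular points. When
  \<open>tr = 0\<close>, \<open>g2\<close> is twice the difference of the two sides of the pull-back
  condition; \<open>k = 0\<close> is the Hamiltonian condition.\<close>

definition "g1 = 2 * (b * (1 + a01 + a21) + a20 * b11)"
definition "g2 = 2 * (a20 * b12 + a21 * b11 + b * a02)"
definition "g3 = 2 * (a21 * b12 + b * a03)"
definition g where "g y = g1 * y + g2 * y\<^sup>2 + g3 * y ^ 3"
definition "k = 2 * (a21 + b12)"
definition "tr = 2 * a20 + b11"
text \<open>The second component of the field divided by \<open>x\<close>. Its
  \<open>x\<close>-derivative is \<open>- 2 * b * x\<close>, so near \<open>(1, 0)\<close> the pair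
  \<open>(y, v)\<close> can replace \<open>(x, y)\<close> as coordinates.\<close>

definition v where "v x y = b11 * y + b12 * y\<^sup>2 - b * (x\<^sup>2 - 1)"

lemma b_pos: "0 < b" using b30 by (simp add: b_def)

lemma g1_pos: "0 < g1" using det by (simp add: g1_def b_def)

lemma snd_F: "snd (F (x, y)) = x * v x y"
  by (simp add: sysF_def v_def b_def algebra_simps power2_eq_square power3_eq_cube)

text \<open>The chain rule gives \<open>v' = x * ((b11 + 2 * b12 * y) * v - 2 * b * x')\<close>,
  which this identity turns into the Lienard form. Such an identity exists because the first
  component of \<open>F\<close> involves \<open>x\<close> only through \<open>x\<^sup>2\<close>,
  which \<open>y\<close> and \<open>v\<close> determine.\<close>

lemma fst_F: "2 * b * fst (F (x, y)) = (b11 + 2 * b12 * y) * v x y - ((tr + k * y) * v x y - g y)"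
  by (simp add: sysF_def v_def g_def g1_def g2_def g3_def k_def tr_def
      algebra_simps power2_eq_square power3_eq_cube)

lemma F_singular: "F (1, 0) = 0" "F (-1, 0) = 0"
  by (simp_all add: sysF_def zero_prod_def)

lemma solution_derivatives:
  assumes "(z has_vector_derivative F (z t)) (at t)"
  defines "x \<equiv> \<lambda>t. fst (z t)" and "y \<equiv> \<lambda>t. snd (z t)"
  shows "(x has_real_derivative fst (F (z t))) (at t)"
    and "(y has_real_derivative x t * v (x t) (y t)) (at t)"
    and "((\<lambda>t. v (x t) (y t)) has_real_derivative
      x t * ((tr + k * y t) * v (x t) (y t) - g (y t))) (at t)"
proof -
  have z: "z t = (x t, y t)" by (simp add: x_def y_def)
  show dx: "(x has_real_derivative fst (F (z t))) (at t)"
    using bounded_linear.has_vector_derivative[OF bounded_linear_fst assms(1)]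
    by (simp add: x_def has_real_derivative_iff_has_vector_derivative)
  have "(y has_real_derivative snd (F (z t))) (at t)"
    using bounded_linear.has_vector_derivative[OF bounded_linear_snd assms(1)]
    by (simp add: y_def has_real_derivative_iff_has_vector_derivative)
  then show dy: "(y has_real_derivative x t * v (x t) (y t)) (at t)"
    by (simp only: z snd_F)
  have "((\<lambda>t. v (x t) (y t)) has_real_derivative
    x t * ((b11 + 2 * b12 * y t) * v (x t) (y t) - 2 * b * fst (F (z t)))) (at t)"
    unfolding v_def by (rule derivative_eq_intros dx dy[unfolded v_def] refl)+ (simp add: algebra_simps)
  then show "((\<lambda>t. v (x t) (y t)) has_real_derivative
      x t * ((tr + k * y t) * v (x t) (y t) - g (y t))) (at t)"
    by (simp only: z fst_F) (simp add: algebra_simps)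
qed

lemma continuous_v [continuous_intros]:
  assumes "continuous_on A p" "continuous_on A q"
  shows "continuous_on A (\<lambda>w. v (p w) (q w))"
  unfolding v_def by (intro continuous_intros assms)

text \<open>Factoring out \<open>y\<^sup>2\<close> leaves polynomials with the positive values
  \<open>g1\<close> and \<open>g1 / 2\<close> at \<open>0\<close>.\<close>

lemma restoring_force:
  obtains \<delta> where "0 < \<delta>" "\<And>y. y \<noteq> 0 \<Longrightarrow> \<bar>y\<bar> < \<delta> \<Longrightarrow> 0 < y * g y"
    "\<And>y. y \<noteq> 0 \<Longrightarrow> \<bar>y\<bar> < \<delta> \<Longrightarrow> 0 < g1 * y\<^sup>2 / 2 + g2 * y ^ 3 / 3 + g3 * y ^ 4 / 4"
proof -
  have "isCont (\<lambda>y. g1 + g2 * y + g3 * y\<^sup>2) 0" "isCont (\<lambda>y. g1 / 2 + g2 * y / 3 + g3 * y\<^sup>2 / 4) 0"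
    by (intro continuous_intros; simp)+
  then have "\<forall>\<^sub>F y in at 0. 0 < g1 + g2 * y + g3 * y\<^sup>2"
    "\<forall>\<^sub>F y in at 0. 0 < g1 / 2 + g2 * y / 3 + g3 * y\<^sup>2 / 4"
    using g1_pos by (auto simp: isCont_def dest: order_tendstoD(1)[of _ _ _ 0])
  then have "\<forall>\<^sub>F y in at 0. 0 < g1 + g2 * y + g3 * y\<^sup>2 \<and> 0 < g1 / 2 + g2 * y / 3 + g3 * y\<^sup>2 / 4"
    by (rule eventually_conj)
  then obtain \<delta> where \<delta>: "0 < \<delta>" and
    ev: "\<And>y. y \<noteq> 0 \<Longrightarrow> \<bar>y\<bar> < \<delta> \<Longrightarrow> 0 < g1 + g2 * y + g3 * y\<^sup>2 \<and> 0 < g1 / 2 + g2 * y / 3 + g3 * y\<^sup>2 / 4"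
    by (auto simp: eventually_at dist_real_def)
  show thesis
  proof
    fix y :: real assume y: "y \<noteq> 0" "\<bar>y\<bar> < \<delta>"
    have "0 < y\<^sup>2 * (g1 + g2 * y + g3 * y\<^sup>2)" "0 < y\<^sup>2 * (g1 / 2 + g2 * y / 3 + g3 * y\<^sup>2 / 4)"
      using ev[OF y] y by auto
    then show "0 < y * g y" "0 < g1 * y\<^sup>2 / 2 + g2 * y ^ 3 / 3 + g3 * y ^ 4 / 4"
      by (simp_all add: g_def algebra_simps power2_eq_square power3_eq_cube power4_eq_xxxx)
  qed (rule \<delta>)
qed

section \<open>Energies that are monotone along orbits\<close>

text \<open>Here \<open>l\<close> is the derivative of \<open>G y + B v\<close> along the Lienard
  system; the original time adds the factor \<open>x\<close>, positive near \<open>(1, 0)\<close>.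
  An orbit on which \<open>l\<close> vanishes satisfies \<open>y * v = 0\<close> throughout, and
  differentiating this product leaves only the singular point.\<close>

lemma not_center_if_energy:
  assumes \<delta>: "0 < \<delta>"
    and B: "\<And>s. \<bar>s\<bar> < \<delta> \<Longrightarrow> (B has_real_derivative B' s) (at s)"
    and B0: "B 0 = 0" and Bpos: "\<And>s. s \<noteq> 0 \<Longrightarrow> \<bar>s\<bar> < \<delta> \<Longrightarrow> 0 < B s"
    and l: "\<And>y s. \<bar>s\<bar> < \<delta> \<Longrightarrow> g y * s + B' s * ((tr + k * y) * s - g y) = l y s"
    and sign: "(\<forall>y s. \<bar>y\<bar> < \<delta> \<longrightarrow> \<bar>s\<bar> < \<delta> \<longrightarrow> l y s \<le> 0) \<or> (\<forall>y s. \<bar>y\<bar> < \<delta> \<longrightarrow> \<bar>s\<bar> < \<delta> \<longrightarrow> 0 \<le> l y s)"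
    and zero: "\<And>y s. \<bar>y\<bar> < \<delta> \<Longrightarrow> \<bar>s\<bar> < \<delta> \<Longrightarrow> l y s = 0 \<Longrightarrow> y * s = 0"
  shows "\<not> is_center F (1, 0)"
proof -
  obtain \<delta>2 where \<delta>2: "0 < \<delta>2" and gpos: "\<And>y. y \<noteq> 0 \<Longrightarrow> \<bar>y\<bar> < \<delta>2 \<Longrightarrow> 0 < y * g y"
    and Gpos: "\<And>y. y \<noteq> 0 \<Longrightarrow> \<bar>y\<bar> < \<delta>2 \<Longrightarrow> 0 < g1 * y\<^sup>2 / 2 + g2 * y ^ 3 / 3 + g3 * y ^ 4 / 4"
    by (rule restoring_force) blast
  define G where "G y = g1 * y\<^sup>2 / 2 + g2 * y ^ 3 / 3 + g3 * y ^ 4 / 4" for y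
  have dG: "(G has_real_derivative g y) (at y)" for y
    unfolding G_def g_def by (auto intro!: derivative_eq_intros)
  define N where "N = {w. 0 < fst w} \<inter> {w. \<bar>snd w\<bar> < min \<delta> \<delta>2} \<inter> {w. \<bar>v (fst w) (snd w)\<bar> < \<delta>}"
  have "open N" unfolding N_def
    by (intro open_Int open_Collect_less continuous_intros)
  moreover have "(1, 0) \<in> N" using \<delta> \<delta>2 by (simp add: N_def v_def)
  ultimately obtain r where r: "0 < r" "cball (1, 0) r \<subseteq> N" by (meson open_contains_cball)
  have N: "0 < fst w" "\<bar>snd w\<bar> < \<delta>" "\<bar>snd w\<bar> < \<delta>2" "\<bar>v (fst w) (snd w)\<bar> < \<delta>"
    if "w \<in> cball (1, 0) r" for w
    using that r(2) by (auto simp: N_def)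
  define L where "L w = G (snd w) + B (v (fst w) (snd w))" for w
  show ?thesis
  proof (rule not_center_if_Lyapunov[where L=L and l="\<lambda>w. fst w * l (snd w) (v (fst w) (snd w))"])
    show "0 < r" by (rule r)
    have "continuous_on {s. \<bar>s\<bar> < \<delta>} B"
      by (intro continuous_at_imp_continuous_on ballI DERIV_isCont[OF B]) simp
    then have "continuous_on (cball (1, 0) r) (\<lambda>w. B (v (fst w) (snd w)))"
      by (rule continuous_on_compose2) (use N in \<open>auto intro!: continuous_intros\<close>)
    then show "continuous_on (cball (1, 0) r) L"
      unfolding L_def G_def by (intro continuous_intros) simp_all
    show "L (1, 0) < L w" if w: "w \<in> cball (1, 0) r" "w \<noteq> (1, 0)" for w
    proof -
      have L0: "L (1, 0) = 0" by (simp add: L_def G_def v_def B0)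
      have G: "0 \<le> G (snd w)" "snd w \<noteq> 0 \<Longrightarrow> 0 < G (snd w)"
        using Gpos[of "snd w"] N[OF w(1)] by (cases "snd w = 0"; simp add: G_def)+
      have Bv: "0 \<le> B (v (fst w) (snd w))" "v (fst w) (snd w) \<noteq> 0 \<Longrightarrow> 0 < B (v (fst w) (snd w))"
        using Bpos[of "v (fst w) (snd w)"] N[OF w(1)] B0
        by (cases "v (fst w) (snd w) = 0"; simp)+
      \<comment> \<open>If \<open>y\<close> and \<open>v\<close> both vanish then
        \<open>x\<^sup>2 = 1\<close>, and positivity of \<open>x\<close> on \<open>N\<close> leaves
        only \<open>(1, 0)\<close>.\<close>
      have "snd w \<noteq> 0 \<or> v (fst w) (snd w) \<noteq> 0"
      proof (rule ccontr)
        assume "\<not> (snd w \<noteq> 0 \<or> v (fst w) (snd w) \<noteq> 0)"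
        then have "snd w = 0" "(fst w)\<^sup>2 = 1" using b_pos by (auto simp: v_def)
        then show False using w N(1)[OF w(1)] by (cases w) (simp add: power2_eq_1_iff)
      qed
      then show ?thesis using G Bv unfolding L0 unfolding L_def by linarith
    qed
    show "((\<lambda>t. L (z t)) has_real_derivative
        fst (z t) * l (snd (z t)) (v (fst (z t)) (snd (z t)))) (at t)"
      if z: "(z has_vector_derivative F (z t)) (at t)" "z t \<in> cball (1, 0) r" for z t
    proof -
      note d = solution_derivatives[OF z(1)]
      note e = l[OF N(4)[OF z(2)], of "snd (z t)", symmetric]
      note dB = DERIV_chain2[where f=B and g="\<lambda>t. v (fst (z t)) (snd (z t))", OF B[OF N(4)[OF z(2)]] d(3)]
      note dG = DERIV_chain2[where f=G and g="\<lambda>t. snd (z t)", OF dG d(2)]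
      show ?thesis unfolding L_def e
        using DERIV_add[OF dG dB] by (rule DERIV_cong) (simp add: algebra_simps)
    qed
    show "(\<forall>w\<in>cball (1, 0) r. fst w * l (snd w) (v (fst w) (snd w)) \<le> 0) \<or>
      (\<forall>w\<in>cball (1, 0) r. 0 \<le> fst w * l (snd w) (v (fst w) (snd w)))"
      using sign
    proof (elim disj_forward ballI)
      show "\<forall>w\<in>cball (1, 0) r. fst w * l (snd w) (v (fst w) (snd w)) \<le> 0"
        if "\<forall>y s. \<bar>y\<bar> < \<delta> \<longrightarrow> \<bar>s\<bar> < \<delta> \<longrightarrow> l y s \<le> 0"
        by (intro ballI mult_nonneg_nonpos) (blast intro: less_imp_le N that[rule_format])+
      show "\<forall>w\<in>cball (1, 0) r. 0 \<le> fst w * l (snd w) (v (fst w) (snd w))"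
        if "\<forall>y s. \<bar>y\<bar> < \<delta> \<longrightarrow> \<bar>s\<bar> < \<delta> \<longrightarrow> 0 \<le> l y s"
        by (intro ballI mult_nonneg_nonneg) (blast intro: less_imp_le N that[rule_format])+
    qed
    fix z
    assume sol: "\<And>t. (z has_vector_derivative F (z t)) (at t)"
      and ball: "\<And>t. z t \<in> cball (1, 0) r"
      and null: "\<And>t. fst (z t) * l (snd (z t)) (v (fst (z t)) (snd (z t))) = 0"
    define x y s where "x = fst (z 0)" and "y = snd (z 0)" and "s = v x y"
    have yv: "snd (z t) * v (fst (z t)) (snd (z t)) = 0" for t
      using null[of t] N[OF ball[of t]] zero[of "snd (z t)" "v (fst (z t)) (snd (z t))"] by auto
    \<comment> \<open>Since \<open>y * v\<close> is constantly zero, this derivative vanishes, and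
      \<open>y * s = 0\<close> reduces it to \<open>s\<^sup>2 = y * g y\<close>. If \<open>y\<close>
      were nonzero then \<open>s = 0\<close>, against \<open>0 < y * g y\<close>.\<close>
    have "((\<lambda>t. snd (z t) * v (fst (z t)) (snd (z t))) has_real_derivative
        x * (s\<^sup>2 + (tr + k * y) * (y * s) - y * g y)) (at 0)"
      by (rule derivative_eq_intros solution_derivatives[OF sol] refl)+
        (simp add: x_def y_def s_def algebra_simps power2_eq_square)
    then have "x * (s\<^sup>2 + (tr + k * y) * (y * s) - y * g y) = 0"
      unfolding yv using DERIV_const DERIV_unique by blast
    moreover have "y * s = 0" using yv[of 0] by (simp add: x_def y_def s_def)
    moreover have x: "0 < x" using N[OF ball[of 0]] by (simp add: x_def)
    ultimately have eq: "s\<^sup>2 = y * g y" and ys: "y = 0 \<or> s = 0" by auto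
    have "y = 0"
    proof (rule ccontr)
      assume "y \<noteq> 0"
      then show False using eq ys gpos[of y] N(3)[OF ball[of 0]] by (auto simp: y_def)
    qed
    then have "s = 0" using eq by simp
    then have "x\<^sup>2 = 1" using \<open>y = 0\<close> b_pos by (simp add: s_def v_def)
    then have "x = 1" using x by (simp add: power2_eq_1_iff)
    then show "\<exists>t. z t = (1, 0)" using \<open>y = 0\<close> by (auto simp: x_def y_def prod_eq_iff)
  qed
qed

text \<open>The quadratic energy has derivative \<open>(tr + k * y) * s\<^sup>2\<close>, whose
  coefficient has the sign of \<open>tr\<close> for small \<open>y\<close>.\<close>

lemma not_center_if_trace:
  assumes "tr \<noteq> 0"
  shows "\<not> is_center F (1, 0)"
proof (rule not_center_if_energy[where B="\<lambda>s. s\<^sup>2 / 2" and l="\<lambda>y s. (tr + k * y) * s\<^sup>2"])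
  \<comment> \<open>This radius forces \<open>\<bar>k * y\<bar> < \<bar>tr\<bar>\<close>; the added
    \<open>1\<close> keeps the denominator positive when \<open>k = 0\<close>.\<close>
  define \<delta> where "\<delta> = \<bar>tr\<bar> / (\<bar>k\<bar> + 1)"
  show "0 < \<delta>" using assms by (simp add: \<delta>_def)
  have small: "\<bar>k * y\<bar> < \<bar>tr\<bar>" if "\<bar>y\<bar> < \<delta>" for y
  proof -
    have "\<bar>k * y\<bar> \<le> (\<bar>k\<bar> + 1) * \<bar>y\<bar>" by (simp add: abs_mult algebra_simps)
    also have "\<dots> < (\<bar>k\<bar> + 1) * \<delta>" using that by (intro mult_strict_left_mono) auto
    also have "\<dots> = \<bar>tr\<bar>" by (simp add: \<delta>_def add_nonneg_eq_0_iff)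
    finally show ?thesis .
  qed
  show "(\<forall>y s. \<bar>y\<bar> < \<delta> \<longrightarrow> \<bar>s\<bar> < \<delta> \<longrightarrow> (tr + k * y) * s\<^sup>2 \<le> 0) \<or>
    (\<forall>y s. \<bar>y\<bar> < \<delta> \<longrightarrow> \<bar>s\<bar> < \<delta> \<longrightarrow> 0 \<le> (tr + k * y) * s\<^sup>2)"
  proof (cases "0 < tr")
    case True
    then have "0 \<le> tr + k * y" if "\<bar>y\<bar> < \<delta>" for y using small[OF that] by linarith
    then show ?thesis by auto
  next
    case False
    then have "tr + k * y \<le> 0" if "\<bar>y\<bar> < \<delta>" for y using small[OF that] by linarith
    then show ?thesis by (auto simp: mult_nonpos_nonneg)
  qed
  show "y * s = 0" if "\<bar>y\<bar> < \<delta>" "(tr + k * y) * s\<^sup>2 = 0" for y s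
    using small[OF that(1)] that(2) by auto
  show "((\<lambda>s. s\<^sup>2 / 2) has_real_derivative s) (at s)" for s :: real
    by (auto intro!: derivative_eq_intros)
  show "g y * s + s * ((tr + k * y) * s - g y) = (tr + k * y) * s\<^sup>2" for y s
    by (simp add: algebra_simps power2_eq_square)
qed auto

text \<open>The energy is chosen so that the term \<open>k g1 y s\<^sup>2\<close> of its derivative cancels exactly, not just
  to leading order.\<close>

lemma not_center_if_weak_focus:
  assumes tr: "tr = 0" and k: "k \<noteq> 0" and g2: "g2 \<noteq> 0"
  shows "\<not> is_center F (1, 0)"
proof -
  \<comment> \<open>With \<open>B' s = s / (1 - \<kappa> * s)\<close> the energy has derivative
    \<open>s\<^sup>2 * (k * y - \<kappa> * g y) / (1 - \<kappa> * s)\<close>. This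
    \<open>\<kappa>\<close> cancels the term linear in \<open>y\<close>.\<close>
  define \<kappa> where "\<kappa> = k / g1"
  have \<kappa>: "\<kappa> \<noteq> 0" "k = \<kappa> * g1" using k g1_pos by (auto simp: \<kappa>_def)
  \<comment> \<open>The first bound keeps \<open>1 - \<kappa> * s\<close> positive, the second gives
    \<open>g2 + g3 * y\<close> the sign of \<open>g2\<close>.\<close>
  define \<delta> where "\<delta> = min (1 / \<bar>\<kappa>\<bar>) (\<bar>g2\<bar> / (\<bar>g3\<bar> + 1))"
  have one: "0 < 1 - \<kappa> * s" if "\<bar>s\<bar> < \<delta>" for s
  proof -
    have "\<bar>s\<bar> < 1 / \<bar>\<kappa>\<bar>" using that by (simp add: \<delta>_def)
    then have "\<bar>\<kappa> * s\<bar> < 1" using \<kappa>(1) by (simp add: abs_mult field_simps)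
    then show ?thesis by linarith
  qed
  have small: "\<bar>g3 * y\<bar> < \<bar>g2\<bar>" if "\<bar>y\<bar> < \<delta>" for y
  proof -
    have "\<bar>g3 * y\<bar> \<le> (\<bar>g3\<bar> + 1) * \<bar>y\<bar>" by (simp add: abs_mult algebra_simps)
    also have "\<dots> < (\<bar>g3\<bar> + 1) * (\<bar>g2\<bar> / (\<bar>g3\<bar> + 1))"
      using that by (intro mult_strict_left_mono) (auto simp: \<delta>_def)
    also have "\<dots> = \<bar>g2\<bar>" by (simp add: add_nonneg_eq_0_iff)
    finally show ?thesis .
  qed
  let ?l = "\<lambda>y s. - (\<kappa> * (g2 + g3 * y)) * ((y * s)\<^sup>2 / (1 - \<kappa> * s))"
  show ?thesis
  proof (rule not_center_if_energy[where B="\<lambda>s. - s / \<kappa> - ln (1 - \<kappa> * s) / \<kappa>\<^sup>2"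
        and B'="\<lambda>s. s / (1 - \<kappa> * s)" and l="?l" and \<delta>=\<delta>])
    show "0 < \<delta>" using \<kappa>(1) g2 by (simp add: \<delta>_def)
    show "((\<lambda>s. - s / \<kappa> - ln (1 - \<kappa> * s) / \<kappa>\<^sup>2) has_real_derivative s / (1 - \<kappa> * s)) (at s)"
      if s: "\<bar>s\<bar> < \<delta>" for s
      using one[OF s] \<kappa>(1) by (auto intro!: derivative_eq_intros simp: field_simps power2_eq_square)
    show "0 < - s / \<kappa> - ln (1 - \<kappa> * s) / \<kappa>\<^sup>2" if s: "s \<noteq> 0" "\<bar>s\<bar> < \<delta>" for s
    proof -
      \<comment> \<open>Positivity of \<open>B\<close> is \<open>ln u \<le> u - 1\<close> at
        \<open>u = 1 - \<kappa> * s\<close>, strict because \<open>u \<noteq> 1\<close>.\<close>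
      have "ln (1 - \<kappa> * s) \<le> - (\<kappa> * s)" using ln_le_minus_one[OF one[OF s(2)]] by simp
      moreover have "ln (1 - \<kappa> * s) \<noteq> - (\<kappa> * s)"
        using ln_eq_minus_one[OF one[OF s(2)]] s(1) \<kappa>(1) by auto
      ultimately have "0 < (- (\<kappa> * s) - ln (1 - \<kappa> * s)) / \<kappa>\<^sup>2" using \<kappa>(1) by simp
      also have "\<dots> = - s / \<kappa> - ln (1 - \<kappa> * s) / \<kappa>\<^sup>2"
        using \<kappa>(1) by (simp add: diff_divide_distrib power2_eq_square)
      finally show ?thesis .
    qed
    show "g y * s + s / (1 - \<kappa> * s) * ((tr + k * y) * s - g y) = ?l y s" if s: "\<bar>s\<bar> < \<delta>" for y s
    proof -
      have "g y * s * (1 - \<kappa> * s) + s * ((tr + k * y) * s - g y) = - (\<kappa> * (g2 + g3 * y)) * (y * s)\<^sup>2"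
        unfolding tr \<kappa>(2) g_def by (simp add: algebra_simps power2_eq_square power3_eq_cube)
      then show ?thesis using one[OF s] by (simp add: field_simps)
    qed
    show "y * s = 0" if "\<bar>y\<bar> < \<delta>" "\<bar>s\<bar> < \<delta>" "?l y s = 0" for y s
      using small[OF that(1)] one[OF that(2)] that(3) \<kappa>(1) by auto
    have nn: "0 \<le> (y * s)\<^sup>2 / (1 - \<kappa> * s)" if "\<bar>s\<bar> < \<delta>" for y s
      using one[OF that] by simp
    show "(\<forall>y s. \<bar>y\<bar> < \<delta> \<longrightarrow> \<bar>s\<bar> < \<delta> \<longrightarrow> ?l y s \<le> 0) \<or> (\<forall>y s. \<bar>y\<bar> < \<delta> \<longrightarrow> \<bar>s\<bar> < \<delta> \<longrightarrow> 0 \<le> ?l y s)"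
    proof (cases "0 < \<kappa> * g2")
      case True
      have "0 \<le> \<kappa> * (g2 + g3 * y)" if "\<bar>y\<bar> < \<delta>" for y
        using small[OF that] True by (auto simp: zero_less_mult_iff zero_le_mult_iff)
      then show ?thesis using nn by (intro disjI1 allI impI) (simp only: minus_mult_left[symmetric] neg_le_0_iff_le mult_nonneg_nonneg)
    next
      case False
      have "\<kappa> * (g2 + g3 * y) \<le> 0" if "\<bar>y\<bar> < \<delta>" for y
        using small[OF that] False \<kappa>(1) g2 by (auto simp: zero_less_mult_iff mult_le_0_iff)
      then show ?thesis using nn by (intro disjI2 allI impI mult_nonneg_nonneg) simp_all
    qed
  qed simp
qed

section \<open>Centers when the variables separate\<close>

text \<open>In the coordinates \<open>y\<close> and \<open>s = v / m y\<close> the hypothesis makes the orbits separable: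
  \<open>h y / m y dy + s / n s ds = 0\<close>.\<close>

lemma center_if_separable:
  assumes tr: "tr = 0"
    and m: "\<And>y. (m has_real_derivative m' y) (at y)" and m0: "0 < m 0"
    and n: "\<And>s. (n has_real_derivative n' s) (at s)" and n0: "0 < n 0"
    and h: "continuous_on UNIV h" "(h has_real_derivative h') (at 0)" "h 0 = 0" "0 < h'"
    and separable: "\<And>y s. m' y * m y * s\<^sup>2 - m y * h y * n s = k * y * (m y * s) - g y"
  shows "is_center F (1, 0)"
proof -
  have contm: "isCont m y" and contn: "isCont n y" for y using m n DERIV_isCont by blast+
  have "\<forall>\<^sub>F y in at 0. 0 < m y" "\<forall>\<^sub>F y in at 0. 0 < n y"
    using contm[of 0] contn[of 0] m0 n0 by (auto simp: isCont_def dest: order_tendstoD(1)[of _ _ _ 0])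
  then have "\<forall>\<^sub>F y in at 0. 0 < m y \<and> 0 < n y" by (rule eventually_conj)
  then obtain d where d: "0 < d" "\<And>y. y \<noteq> 0 \<Longrightarrow> \<bar>y\<bar> < d \<Longrightarrow> 0 < m y \<and> 0 < n y"
    by (auto simp: eventually_at dist_real_def)
  define \<delta> where "\<delta> = d / 2"
  have \<delta>: "0 < \<delta>" using d by (simp add: \<delta>_def)
  have pos: "0 < m y" "0 < n y" if "\<bar>y\<bar> \<le> \<delta>" for y
  proof -
    have "\<bar>y\<bar> < d" using that d(1) by (simp add: \<delta>_def)
    then show "0 < m y" "0 < n y" using d(2)[of y] m0 n0 by (cases "y = 0"; simp)+
  qed
  have c1: "continuous_on {-\<delta>..\<delta>} (\<lambda>y. h y / m y)"
    using contm pos by (intro continuous_intros continuous_on_subset[OF h(1)]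
        continuous_at_imp_continuous_on) (auto simp: abs_le_iff less_imp_neq[symmetric])
  have d1: "((\<lambda>y. h y / m y) has_real_derivative h' / m 0) (at 0)"
    by (rule derivative_eq_intros h(2) m refl)+ (use m0 h(3) in auto)
  obtain R1 \<alpha> \<alpha>' where R1: "0 < R1" and \<alpha>0: "\<alpha> 0 = 0" and cont\<alpha>': "continuous_on {-R1<..<R1} \<alpha>'"
    and \<alpha>: "\<And>Y. \<bar>Y\<bar> < R1 \<Longrightarrow> \<bar>\<alpha> Y\<bar> < \<delta>" and \<alpha>'pos: "\<And>Y. \<bar>Y\<bar> < R1 \<Longrightarrow> 0 < \<alpha>' Y"
    and d\<alpha>: "\<And>Y. \<bar>Y\<bar> < R1 \<Longrightarrow> (\<alpha> has_real_derivative \<alpha>' Y) (at Y)"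
    and \<alpha>eq: "\<And>Y. \<bar>Y\<bar> < R1 \<Longrightarrow> h (\<alpha> Y) / m (\<alpha> Y) * \<alpha>' Y = Y"
    by (rule straightening_coordinate[OF \<delta> c1 _ d1]) (use h m0 in auto)
  have c2: "continuous_on {-\<delta>..\<delta>} (\<lambda>s. s / n s)"
    using contn pos by (intro continuous_intros
        continuous_at_imp_continuous_on) (auto simp: abs_le_iff less_imp_neq[symmetric])
  have d2: "((\<lambda>s. s / n s) has_real_derivative 1 / n 0) (at 0)"
    by (rule derivative_eq_intros n refl)+ (use n0 in auto)
  obtain R2 \<beta> \<beta>' where R2: "0 < R2" and \<beta>0: "\<beta> 0 = 0" and cont\<beta>': "continuous_on {-R2<..<R2} \<beta>'"
    and \<beta>: "\<And>S. \<bar>S\<bar> < R2 \<Longrightarrow> \<bar>\<beta> S\<bar> < \<delta>" and \<beta>'pos: "\<And>S. \<bar>S\<bar> < R2 \<Longrightarrow> 0 < \<beta>' S"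
    and d\<beta>: "\<And>S. \<bar>S\<bar> < R2 \<Longrightarrow> (\<beta> has_real_derivative \<beta>' S) (at S)"
    and \<beta>eq: "\<And>S. \<bar>S\<bar> < R2 \<Longrightarrow> \<beta> S / n (\<beta> S) * \<beta>' S = S"
    by (rule straightening_coordinate[OF \<delta> c2 _ d2]) (use n0 in auto)
  define y s where "y q = \<alpha> (fst q)" and "s q = \<beta> (snd q)" for q :: "real \<times> real"
  \<comment> \<open>\<open>e\<close> is \<open>x\<^sup>2\<close> as obtained by solving
    \<open>v x y = m y * s\<close>.\<close>
  define e where "e q = 1 + (b11 * y q + b12 * (y q)\<^sup>2 - m (y q) * s q) / b" for q
  define N where "N = {q :: real \<times> real. \<bar>fst q\<bar> < R1} \<inter> {q. \<bar>snd q\<bar> < R2}"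
  have openN: "open N" unfolding N_def by (intro open_Int open_Collect_less continuous_intros)
  have cont\<alpha>: "continuous_on {-R1<..<R1} \<alpha>"
    by (intro continuous_at_imp_continuous_on ballI DERIV_isCont[OF d\<alpha>]) auto
  have cont\<beta>: "continuous_on {-R2<..<R2} \<beta>"
    by (intro continuous_at_imp_continuous_on ballI DERIV_isCont[OF d\<beta>]) auto
  have conty: "continuous_on N y" and conty': "continuous_on N (\<lambda>q. \<alpha>' (fst q))"
    unfolding y_def by (rule continuous_on_compose2[OF cont\<alpha>] continuous_on_compose2[OF cont\<alpha>'];
        auto intro!: continuous_intros simp: N_def)+
  have conts: "continuous_on N s" and conts': "continuous_on N (\<lambda>q. \<beta>' (snd q))"
    unfolding s_def by (rule continuous_on_compose2[OF cont\<beta>] continuous_on_compose2[OF cont\<beta>'];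
        auto intro!: continuous_intros simp: N_def)+
  have contm': "continuous_on UNIV m" and contn': "continuous_on UNIV n"
    by (intro continuous_at_imp_continuous_on ballI contm contn)+
  have contmy: "continuous_on N (\<lambda>q. m (y q))" and contns: "continuous_on N (\<lambda>q. n (s q))"
    by (rule continuous_on_compose2[OF contm' conty] continuous_on_compose2[OF contn' conts]; simp)+
  have conte: "continuous_on N e"
    unfolding e_def by (intro continuous_intros conty conts contmy) (use b_pos in auto)
  have "open (N \<inter> e -` {0<..})" by (rule continuous_open_preimage[OF conte openN]) simp
  moreover have "0 \<in> N \<inter> e -` {0<..}" using R1 R2 by (simp add: N_def e_def y_def s_def \<alpha>0 \<beta>0)
  ultimately obtain R where R: "0 < R" "ball 0 R \<subseteq> N \<inter> e -` {0<..}" by (meson open_contains_ball)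
  have in_ball: "\<bar>fst q\<bar> < R1" "\<bar>snd q\<bar> < R2" "0 < e q" if "q \<in> ball 0 R" for q
    using that R(2) by (auto simp: N_def)
  define x where "x q = sqrt (e q)" for q
  define \<Gamma> where "\<Gamma> q = (x q, y q)" for q
  \<comment> \<open>This speed makes the rotation become \<open>y' = x * m y * s\<close>,
    \<open>s' = - x * h y * n s\<close> under \<open>\<alpha>\<close> and \<open>\<beta>\<close>. By
    \<open>separable\<close>, the product \<open>m y * s\<close> then obeys the equation for
    \<open>v\<close> with time factor \<open>x\<close>.\<close>
  define \<omega> where "\<omega> q = x q * m (y q) * n (s q) / (\<alpha>' (fst q) * \<beta>' (snd q))" for q
  have xpos: "0 < x q" if "q \<in> ball 0 R" for q using in_ball(3)[OF that] by (simp add: x_def)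
  have vxy: "v (x q) (y q) = m (y q) * s q" if "q \<in> ball 0 R" for q
    using in_ball(3)[OF that] b_pos by (simp add: v_def x_def e_def)
  have mpos: "0 < m (y q)" and npos: "0 < n (s q)" if "q \<in> ball 0 R" for q
    using pos \<alpha>[of "fst q"] \<beta>[of "snd q"] in_ball[OF that]
    by (simp_all add: y_def s_def less_imp_le)
  have inj\<alpha>: "Y = Y'" if "\<bar>Y\<bar> < R1" "\<bar>Y'\<bar> < R1" "\<alpha> Y = \<alpha> Y'" for Y Y'
  proof (rule ccontr)
    have mono: "\<alpha> c < \<alpha> d" if "\<bar>c\<bar> < R1" "\<bar>d\<bar> < R1" "c < d" for c d
      using that(3)
    proof (rule DERIV_pos_imp_increasing)
      show "\<exists>D. (\<alpha> has_real_derivative D) (at u) \<and> 0 < D" if u: "c \<le> u" "u \<le> d" for u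
      proof -
        have "\<bar>u\<bar> < R1" using u \<open>\<bar>c\<bar> < R1\<close> \<open>\<bar>d\<bar> < R1\<close> by linarith
        then show ?thesis using d\<alpha> \<alpha>'pos by blast
      qed
    qed
    assume "Y \<noteq> Y'"
    then show False using mono[of Y Y'] mono[of Y' Y] that by linarith
  qed
  have inj\<beta>: "S = S'" if "\<bar>S\<bar> < R2" "\<bar>S'\<bar> < R2" "\<beta> S = \<beta> S'" for S S'
  proof (rule ccontr)
    have mono: "\<beta> c < \<beta> d" if "\<bar>c\<bar> < R2" "\<bar>d\<bar> < R2" "c < d" for c d
      using that(3)
    proof (rule DERIV_pos_imp_increasing)
      show "\<exists>D. (\<beta> has_real_derivative D) (at u) \<and> 0 < D" if u: "c \<le> u" "u \<le> d" for u
      proof -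
        have "\<bar>u\<bar> < R2" using u \<open>\<bar>c\<bar> < R2\<close> \<open>\<bar>d\<bar> < R2\<close> by linarith
        then show ?thesis using d\<beta> \<beta>'pos by blast
      qed
    qed
    assume "S \<noteq> S'"
    then show False using mono[of S S'] mono[of S' S] that by linarith
  qed
  have \<Gamma>0: "\<Gamma> 0 = (1, 0)" by (simp add: \<Gamma>_def x_def e_def y_def s_def \<alpha>0 \<beta>0)
  have "is_center F (\<Gamma> 0)"
  proof (rule is_center_if_conjugate_to_rotation[OF R(1), where \<omega>=\<omega>])
    have sub: "ball 0 R \<subseteq> N" using R(2) by auto
    have contx: "continuous_on N x" unfolding x_def by (intro continuous_intros conte)
    show "continuous_on (ball 0 R) \<Gamma>"
      unfolding \<Gamma>_def by (intro continuous_on_subset[OF _ sub] continuous_intros contx conty)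
    show "continuous_on (ball 0 R) \<omega>"
      unfolding \<omega>_def
    proof (intro continuous_intros)
      show "\<forall>q\<in>ball 0 R. \<alpha>' (fst q) * \<beta>' (snd q) \<noteq> 0"
        using in_ball \<alpha>'pos \<beta>'pos by (metis less_irrefl mult_eq_0_iff)
    qed (rule continuous_on_subset[OF _ sub], (rule contx contmy contns conty' conts'))+
    show "0 < \<omega> q" if "q \<in> ball 0 R" for q
      using in_ball[OF that] xpos[OF that] mpos[OF that] npos[OF that] \<alpha>'pos \<beta>'pos
      by (simp add: \<omega>_def)
    \<comment> \<open>\<open>x\<close> and \<open>y\<close> determine \<open>v\<close>, hence
      \<open>s = v / m y\<close>; then \<open>\<alpha>\<close> and \<open>\<beta>\<close> are
      inverted.\<close>
    show "inj_on \<Gamma> (ball 0 R)"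
    proof (rule inj_onI)
      fix q q' assume q: "q \<in> ball 0 R" and q': "q' \<in> ball 0 R" and eq: "\<Gamma> q = \<Gamma> q'"
      from eq have xy: "x q = x q'" "y q = y q'" by (simp_all add: \<Gamma>_def)
      then have "m (y q) * s q = m (y q) * s q'" using vxy[OF q] vxy[OF q'] by metis
      then have "s q = s q'" using mpos[OF q] by simp
      then have "snd q = snd q'"
        using inj\<beta>[OF in_ball(2)[OF q] in_ball(2)[OF q']] by (simp add: s_def)
      moreover have "fst q = fst q'"
        using inj\<alpha>[OF in_ball(1)[OF q] in_ball(1)[OF q']] xy(2) by (simp add: y_def)
      ultimately show "q = q'" by (simp add: prod_eq_iff)
    qed
    show "F (\<Gamma> 0) = 0" by (simp add: \<Gamma>0 F_singular)
    show "F (\<Gamma> q) \<noteq> 0" if q: "q \<in> ball 0 R" "q \<noteq> 0" for q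
    proof
      assume zero: "F (\<Gamma> q) = 0"
      have "v (x q) (y q) = 0"
        using snd_F[of "x q" "y q"] zero xpos[OF q(1)] by (simp add: \<Gamma>_def)
      moreover from this have "g (y q) = 0"
        using fst_F[of "x q" "y q"] zero by (simp add: \<Gamma>_def)
      ultimately have "s q = 0" "h (y q) = 0"
        using vxy[OF q(1)] mpos[OF q(1)] separable[of "y q" "s q"] npos[OF q(1)] by auto
      then have "fst q = 0" "snd q = 0"
        using \<alpha>eq[of "fst q"] \<beta>eq[of "snd q"] in_ball[OF q(1)] by (auto simp: y_def s_def)
      then show False using q(2) by (simp add: prod_eq_iff)
    qed
    fix Y S :: "real \<Rightarrow> real" and t
    assume dY: "(Y has_real_derivative \<omega> (Y t, S t) * S t) (at t)"
      and dS: "(S has_real_derivative - (\<omega> (Y t, S t) * Y t)) (at t)"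
      and q: "(Y t, S t) \<in> ball 0 R"
    define q where "q t = (Y t, S t)" for t
    have qt: "q t \<in> ball 0 R" using q by (simp add: q_def)
    note ib = in_ball[OF qt, unfolded q_def fst_conv snd_conv]
    have dy: "((\<lambda>t. y (q t)) has_real_derivative x (q t) * (m (y (q t)) * s (q t))) (at t)"
    proof -
      have eq: "\<alpha>' (Y t) * (\<omega> (Y t, S t) * S t) = x (q t) * (m (y (q t)) * s (q t))"
        using \<beta>eq[OF ib(2)] \<alpha>'pos[OF ib(1)] \<beta>'pos[OF ib(2)] npos[OF qt]
        by (simp add: \<omega>_def s_def q_def field_simps)
      show ?thesis using DERIV_chain2[where f=\<alpha> and g=Y, OF d\<alpha>[OF ib(1)] dY] unfolding eq by (simp add: y_def q_def)
    qed
    have ds: "((\<lambda>t. s (q t)) has_real_derivative - (x (q t) * (h (y (q t)) * n (s (q t))))) (at t)"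
    proof -
      have eq: "\<beta>' (S t) * - (\<omega> (Y t, S t) * Y t) = - (x (q t) * (h (y (q t)) * n (s (q t))))"
        using \<alpha>eq[OF ib(1)] \<alpha>'pos[OF ib(1)] \<beta>'pos[OF ib(2)] mpos[OF qt]
        by (simp add: \<omega>_def y_def q_def field_simps)
      show ?thesis using DERIV_chain2[where f=\<beta> and g=S, OF d\<beta>[OF ib(2)] dS] unfolding eq by (simp add: s_def q_def)
    qed
    \<comment> \<open>The derivative of \<open>x\<^sup>2\<close>: the formula for \<open>e\<close>
      is differentiated, and \<open>separable\<close> with \<open>fst_F\<close> brings the result to
      the form \<open>2 * x * x'\<close>.\<close>
    have de: "((\<lambda>t. e (q t)) has_real_derivative 2 * x (q t) * fst (F (\<Gamma> (q t)))) (at t)"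
    proof -
      let ?x = "x (q t)" and ?y = "y (q t)" and ?s = "s (q t)"
      have dn: "((\<lambda>t. b11 * y (q t) + b12 * (y (q t))\<^sup>2 - m (y (q t)) * s (q t)) has_real_derivative
          b11 * (?x * (m ?y * ?s)) + b12 * (2 * ?y * (?x * (m ?y * ?s)))
          - (m' ?y * (?x * (m ?y * ?s)) * ?s - m ?y * (?x * (h ?y * n ?s)))) (at t)"
        by (rule derivative_eq_intros dy ds DERIV_chain2[where f=m and g="\<lambda>t. y (q t)", OF m dy] refl)+
          (simp add: algebra_simps)
      have "b11 * (?x * (m ?y * ?s)) + b12 * (2 * ?y * (?x * (m ?y * ?s)))
          - (m' ?y * (?x * (m ?y * ?s)) * ?s - m ?y * (?x * (h ?y * n ?s))) =
          ?x * ((b11 + 2 * b12 * ?y) * (m ?y * ?s) - (m' ?y * m ?y * ?s\<^sup>2 - m ?y * h ?y * n ?s))"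
        by (simp add: algebra_simps power2_eq_square)
      also have "\<dots> = ?x * (2 * b * fst (F (\<Gamma> (q t))))"
        unfolding separable \<Gamma>_def fst_F vxy[OF qt] tr by (simp add: algebra_simps)
      finally have dn': "((\<lambda>t. b11 * y (q t) + b12 * (y (q t))\<^sup>2 - m (y (q t)) * s (q t)) has_real_derivative
          ?x * (2 * b * fst (F (\<Gamma> (q t))))) (at t)"
        using dn by (simp only:)
      show ?thesis unfolding e_def
        by (rule DERIV_cong[OF DERIV_add[OF DERIV_const DERIV_cdivide[OF dn']]]) (use b_pos in simp)
    qed
    have dx: "((\<lambda>t. x (q t)) has_real_derivative fst (F (\<Gamma> (q t)))) (at t)"
      unfolding x_def using in_ball(3)[OF qt] xpos[OF qt]
      by (auto intro!: derivative_eq_intros de simp: x_def field_simps)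
    have "snd (F (\<Gamma> (q t))) = x (q t) * (m (y (q t)) * s (q t))"
      unfolding \<Gamma>_def snd_F vxy[OF qt] ..
    then have "((\<lambda>t. \<Gamma> (q t)) has_vector_derivative (fst (F (\<Gamma> (q t))), snd (F (\<Gamma> (q t))))) (at t)"
      using dx dy unfolding \<Gamma>_def
      by (intro has_vector_derivative_Pair) (simp_all add: has_real_derivative_iff_has_vector_derivative)
    then show "((\<lambda>t. \<Gamma> (Y t, S t)) has_vector_derivative F (\<Gamma> (Y t, S t))) (at t)"
      by (simp add: q_def)
  qed
  then show ?thesis by (simp add: \<Gamma>0)
qed

text \<open>The system \<open>y' = v\<close>, \<open>v' = - g y\<close> is already separable, with
  \<open>s = v\<close>.\<close>

lemma center_if_Hamiltonian:
  assumes "tr = 0" "k = 0"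
  shows "is_center F (1, 0)"
proof (rule center_if_separable[where m="\<lambda>_. 1" and m'="\<lambda>_. 0" and n="\<lambda>_. 1" and n'="\<lambda>_. 0"
      and h=g and h'=g1])
  show "continuous_on UNIV g" unfolding g_def by (intro continuous_intros)
  show "(g has_real_derivative g1) (at 0)" unfolding g_def by (auto intro!: derivative_eq_intros)
qed (use assms g1_pos in \<open>auto simp: g_def\<close>)

text \<open>Now \<open>g y = y * m y\<close> with \<open>m y = g1 + g3 * y\<^sup>2\<close>. For
  \<open>s = v / m y\<close> the Lienard system gives
  \<open>s' = - y * (1 - k * s + 2 * g3 * s\<^sup>2)\<close>, a product of a function of
  \<open>y\<close> and a function of \<open>s\<close>.\<close>

lemma center_if_pullback:
  assumes "tr = 0" "g2 = 0"
  shows "is_center F (1, 0)"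
proof (rule center_if_separable[where m="\<lambda>y. g1 + g3 * y\<^sup>2" and m'="\<lambda>y. 2 * g3 * y"
      and n="\<lambda>s. 1 - k * s + 2 * g3 * s\<^sup>2" and n'="\<lambda>s. 4 * g3 * s - k" and h="\<lambda>y. y" and h'=1])
  show "2 * g3 * y * (g1 + g3 * y\<^sup>2) * s\<^sup>2 - (g1 + g3 * y\<^sup>2) * y * (1 - k * s + 2 * g3 * s\<^sup>2) =
      k * y * ((g1 + g3 * y\<^sup>2) * s) - g y" for y s
    by (simp add: g_def assms(2) algebra_simps power2_eq_square power3_eq_cube)
qed (use assms g1_pos in \<open>auto intro!: derivative_eq_intros continuous_intros\<close>)

section \<open>The second singular point, nondegeneracy and the equivalence\<close>

text \<open>Reversibility: the reflection \<open>\<rho>\<close> in the \<open>y\<close>-axis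
  transforms \<open>F\<close> into \<open>- F\<close>, so closed orbits go to closed orbits
  traversed backwards.\<close>

lemma center_reflected:
  assumes "is_center F (1, 0)"
  shows "is_center F (-1, 0)"
proof -
  define \<rho> where "\<rho> w = (- fst w, snd w)" for w :: "real \<times> real"
  have \<rho>\<rho>: "\<rho> (\<rho> w) = w" for w by (simp add: \<rho>_def)
  have F\<rho>: "F (\<rho> w) = (fst (F w), - snd (F w))" for w
    by (cases w) (simp add: \<rho>_def sysF_def algebra_simps)
  obtain U where U: "open U" "(1, 0) \<in> U" "simply_connected U"
    and per: "\<And>q. q \<in> U - {(1, 0)} \<Longrightarrow> F q \<noteq> 0 \<and> periodic_orbit_in F q (U - {(1, 0)})"
    using assms unfolding is_center_def by blast
  have "linear \<rho>" by (intro linearI) (auto simp: \<rho>_def)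
  moreover have inj: "inj \<rho>" by (metis \<rho>\<rho> injI)
  ultimately have "U homeomorphic \<rho> ` U" by (rule linear_homeomorphic_image)
  have "\<rho> ` U = \<rho> -` U" by (force simp: \<rho>\<rho> image_iff intro: \<rho>\<rho>[symmetric])
  moreover have "open (\<rho> -` U)"
    by (rule open_vimage[OF U(1)]) (auto simp: \<rho>_def intro!: continuous_intros)
  ultimately have "open (\<rho> ` U)" by simp
  show ?thesis
    unfolding is_center_def
  proof (intro conjI exI ballI)
    show "F (-1, 0) = 0" by (rule F_singular)
    show "open (\<rho> ` U)" by fact
    show "simply_connected (\<rho> ` U)"
      using U(3) \<open>U homeomorphic \<rho> ` U\<close> homeomorphic_simply_connected by blast
    show "(-1, 0) \<in> \<rho> ` U" using U(2) by (force simp: \<rho>_def)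
    fix c assume "c \<in> \<rho> ` U - {(-1, 0)}"
    then obtain q where "q \<in> U" and c: "c = \<rho> q" "\<rho> q \<noteq> (-1, 0)" by blast
    then have q: "q \<in> U - {(1, 0)}" by (auto simp: \<rho>_def)
    show "F c \<noteq> 0" using per[OF q] unfolding c(1) F\<rho> by (auto simp: prod_eq_iff)
    obtain z T where T: "0 < T" and z: "z 0 = q" "\<And>t. (z has_vector_derivative F (z t)) (at t)"
      "\<And>t. z (t + T) = z t" "\<And>t. z t \<in> U - {(1, 0)}"
      using per[OF q] unfolding periodic_orbit_in_def by auto
    let ?z = "\<lambda>t. \<rho> (z (- t))"
    have "(?z has_vector_derivative F (?z t)) (at t)" for t
    proof -
      have "(z has_vector_derivative F (z (- t))) (at (- t))" by (rule z)
      moreover have "(uminus has_vector_derivative (- 1 :: real)) (at t)"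
        using DERIV_minus[OF DERIV_ident, of t UNIV]
        by (simp add: has_real_derivative_iff_has_vector_derivative)
      ultimately have "((\<lambda>t. z (- t)) has_vector_derivative - F (z (- t))) (at t)"
        using vector_diff_chain_at[of uminus "-1" t z "F (z (- t))"] by (simp add: o_def)
      moreover have "bounded_linear \<rho>" using \<open>linear \<rho>\<close> by (simp add: linear_conv_bounded_linear)
      ultimately have "(?z has_vector_derivative \<rho> (- F (z (- t)))) (at t)"
        by (rule bounded_linear.has_vector_derivative[rotated])
      moreover have "\<rho> (- F (z (- t))) = F (?z t)" unfolding F\<rho> by (simp add: \<rho>_def)
      ultimately show ?thesis by simp
    qed
    moreover have "?z (t + T) = ?z t" for t
    proof -
      have "- (t + T) + T = - t" by simp
      then show ?thesis using z(3) by metis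
    qed
    moreover have "?z t \<in> \<rho> ` U - {(-1, 0)}" for t
    proof -
      have "\<rho> (z (- t)) \<noteq> (-1, 0)" using z(4)[of "-t"] by (auto simp: \<rho>_def prod_eq_iff)
      then show ?thesis using z(4)[of "-t"] by blast
    qed
    ultimately show "periodic_orbit_in F c (\<rho> ` U - {(-1, 0)})"
      unfolding periodic_orbit_in_def using T z(1) c(1)
      by (intro exI[of _ ?z] exI[of _ T]) auto
  qed
qed

text \<open>The determinant contains \<open>\<sigma>\<close> only squared, so both singular points
  are treated at once; its value is \<open>g1\<close>.\<close>

lemma nondegenerate:
  assumes "\<sigma>\<^sup>2 = 1"
  shows "\<exists>L. (F has_derivative L) (at (\<sigma>, 0)) \<and> cross2 (L (1, 0)) (L (0, 1)) \<noteq> 0"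
proof (intro exI conjI)
  have F: "F = (\<lambda>w. (snd w + a20 * ((fst w)^2 - 1) + a21 * (fst w)^2 * snd w + a01 * snd w + a02 * (snd w)^2
      + a03 * (snd w)^3, fst w - (fst w)^3 + b30 * ((fst w)^3 - fst w) + b11 * fst w * snd w
      + b12 * fst w * (snd w)^2))"
    by (auto simp: sysF_def)
  have [simp]: "\<sigma> * (\<sigma> * c) = c" for c
    using assms by (simp add: power2_eq_square flip: mult.assoc)
  show "(F has_derivative (\<lambda>w. (2 * a20 * \<sigma> * fst w + (1 + a01 + a21) * snd w,
      - 2 * b * fst w + b11 * \<sigma> * snd w))) (at (\<sigma>, 0))"
    unfolding F using assms
    by (auto intro!: derivative_eq_intros simp: fun_eq_iff b_def algebra_simps power2_eq_square power3_eq_cube)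
  have "2 * a20 * \<sigma> * (b11 * \<sigma>) + (1 + a01 + a21) * (2 * b) = g1"
    using assms by (simp add: g1_def algebra_simps power2_eq_square)
  then show "cross2 (2 * a20 * \<sigma> * fst (1, 0) + (1 + a01 + a21) * snd (1, 0),
        - 2 * b * fst (1, 0) + b11 * \<sigma> * snd (1, 0))
      (2 * a20 * \<sigma> * fst (0, 1) + (1 + a01 + a21) * snd (0, 1),
        - 2 * b * fst (0, 1) + b11 * \<sigma> * snd (0, 1)) \<noteq> 0"
    using g1_pos by (simp add: cross2_def algebra_simps)
qed

lemma nondeg_center_iff:
  "nondeg_center F (1, 0) \<and> nondeg_center F (-1, 0) \<longleftrightarrow> tr = 0 \<and> (k = 0 \<or> g2 = 0)"
proof
  assume "nondeg_center F (1, 0) \<and> nondeg_center F (-1, 0)"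
  then have "is_center F (1, 0)" by (simp add: nondeg_center_def)
  then show "tr = 0 \<and> (k = 0 \<or> g2 = 0)"
    using not_center_if_trace not_center_if_weak_focus by blast
next
  assume "tr = 0 \<and> (k = 0 \<or> g2 = 0)"
  then have "is_center F (1, 0)" using center_if_Hamiltonian center_if_pullback by blast
  then show "nondeg_center F (1, 0) \<and> nondeg_center F (-1, 0)"
    using center_reflected nondegenerate by (simp add: nondeg_center_def)
qed

section \<open>The linear system behind the pull-back\<close>

text \<open>The first component of \<open>pbmap b30 b11 b12\<close> is \<open>- v / b\<close>, and \<open>(v, y\<^sup>2)\<close> satisfies a
  linear system up to the time factor \<open>x y\<close>.\<close>

lemma pullback_of_linear:
  assumes tr: "tr = 0" and g2: "g2 = 0"
  shows "\<exists>Y. linear_planar_field Y \<and> pullback_foliation F (pbmap b30 b11 b12) Y"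
proof (intro exI conjI)
  \<comment> \<open>As \<open>g y / y = g1 + g3 * y\<^sup>2\<close>, dividing the derivatives of
    \<open>- v / b\<close> and \<open>y\<^sup>2\<close> by \<open>x * y\<close> leaves these affine
    expressions. The zero terms match the shape in \<open>linear_planar_field\<close>.\<close>
  let ?Y = "\<lambda>(p, q). (k * p + g3 / b * q + g1 / b, - (2 * b) * p + 0 * q + 0)"
  have "(k, g3 / b, g1 / b, - (2 * b), 0, 0) \<noteq> (0, 0, 0, 0, 0, 0) \<and>
      (\<forall>p q. ?Y (p, q) = (k * p + g3 / b * q + g1 / b, - (2 * b) * p + 0 * q + 0))"
    using b_pos by simp
  then show "linear_planar_field ?Y"
    unfolding linear_planar_field_def
    by - (rule exI, rule exI, rule exI, rule exI, rule exI, rule exI, assumption)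
  show "pullback_foliation F (pbmap b30 b11 b12) ?Y"
    unfolding pullback_foliation_def
  proof
    fix z :: "real \<times> real"
    obtain x y where z: "z = (x, y)" by (cases z)
    let ?D = "\<lambda>w. (2 * x * fst w - (b11 + 2 * b12 * y) * snd w / b, 2 * y * snd w)"
    have pb: "pbmap b30 b11 b12 = (\<lambda>w. ((fst w)\<^sup>2 - 1 - (b11 * snd w + b12 * (snd w)\<^sup>2) / b, (snd w)\<^sup>2))"
      using b_pos by (auto simp: pbmap_def b_def fun_eq_iff divide_simps) (simp add: algebra_simps)
    have dpb: "(pbmap b30 b11 b12 has_derivative ?D) (at z)"
      unfolding pb z using b_pos
      by (auto intro!: derivative_eq_intros simp: fun_eq_iff field_simps)
    have pbz: "pbmap b30 b11 b12 z = (- v x y / b, y\<^sup>2)"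
      using b_pos by (simp add: pb z v_def field_simps)
    have F1: "fst (F z) = ((b11 + 2 * b12 * y) * v x y - (k * y * v x y - g y)) / (2 * b)"
      using fst_F[of x y] b_pos by (simp add: z tr field_simps)
    have F2: "snd (F z) = x * v x y" unfolding z by (rule snd_F)
    have g: "g y = y * (g1 + g3 * y\<^sup>2)"
      by (simp add: g_def g2 algebra_simps power2_eq_square power3_eq_cube)
    have D: "?D (F z) = (x * y * (k * (- v x y / b) + g3 / b * y\<^sup>2 + g1 / b), x * y * (- (2 * b) * (- v x y / b)))"
      unfolding F1 F2 g using b_pos by (simp add: field_simps)
    have "cross2 (?D (F z)) (?Y (pbmap b30 b11 b12 z)) = 0"
      unfolding D pbz by (simp add: cross2_def algebra_simps)
    with dpb show "\<exists>D. (pbmap b30 b11 b12 has_derivative D) (at z) \<and>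
        cross2 (D (F z)) (?Y (pbmap b30 b11 b12 z)) = 0" by blast
  qed
qed

end

theorem theorem2:
  "\<exists>\<epsilon>>0. \<forall>a20 a21 a01 a02 a03 b30 b11 b12 :: real.
     \<bar>a20\<bar> < \<epsilon> \<and> \<bar>a21\<bar> < \<epsilon> \<and> \<bar>a01\<bar> < \<epsilon> \<and> \<bar>a02\<bar> < \<epsilon> \<and>
     \<bar>a03\<bar> < \<epsilon> \<and> \<bar>b30\<bar> < \<epsilon> \<and> \<bar>b11\<bar> < \<epsilon> \<and> \<bar>b12\<bar> < \<epsilon> \<longrightarrow>
     (let F = sysF a20 a21 a01 a02 a03 b30 b11 b12 in
        F (1, 0) = (0, 0) \<and> F (-1, 0) = (0, 0) \<and>
        ((nondeg_center F (1, 0) \<and> nondeg_center F (-1, 0)) \<longleftrightarrow>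
           (2 * a20 + b11 = 0 \<and>
            (a21 + b12 = 0 \<or> (1 - b30) * a02 = a20 * (2 * a21 - b12)))) \<and>
        (2 * a20 + b11 = 0 \<and> (1 - b30) * a02 = a20 * (2 * a21 - b12) \<longrightarrow>
           (\<exists>Y. linear_planar_field Y \<and> pullback_foliation F (pbmap b30 b11 b12) Y)))"
\<comment> \<open>With this bound \<open>1 - b30\<close> and \<open>1 + a01 + a21\<close> are at
  least \<open>1 / 2\<close>, so their product outweighs
  \<open>\<bar>a20 * b11\<bar> \<le> 1 / 100\<close>.\<close>
proof (intro exI[of _ "1 / 10"] conjI allI impI)
  show "0 < (1 / 10 :: real)" by simp
  fix a20 a21 a01 a02 a03 b30 b11 b12 :: real
  assume "\<bar>a20\<bar> < 1 / 10 \<and> \<bar>a21\<bar> < 1 / 10 \<and> \<bar>a01\<bar> < 1 / 10 \<and> \<bar>a02\<bar> < 1 / 10 \<and>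
     \<bar>a03\<bar> < 1 / 10 \<and> \<bar>b30\<bar> < 1 / 10 \<and> \<bar>b11\<bar> < 1 / 10 \<and> \<bar>b12\<bar> < 1 / 10"
  then have small: "\<bar>a20\<bar> < 1 / 10" "\<bar>a21\<bar> < 1 / 10" "\<bar>a01\<bar> < 1 / 10" "\<bar>b30\<bar> < 1 / 10" "\<bar>b11\<bar> < 1 / 10"
    by blast+
  interpret reversible_cubic a20 a21 a01 a02 a03 b30 b11 b12
  proof
    show "b30 < 1" using small by linarith
    have "1 / 2 * (1 / 2) \<le> (1 - b30) * (1 + a01 + a21)"
      using small by (intro mult_mono) linarith+
    moreover have "\<bar>a20 * b11\<bar> \<le> 1 / 10 * (1 / 10)"
      unfolding abs_mult using small by (intro mult_mono) linarith+
    ultimately show "0 < (1 - b30) * (1 + a01 + a21) + a20 * b11" by linarith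
  qed
  have pb: "g2 = 0 \<longleftrightarrow> (1 - b30) * a02 = a20 * (2 * a21 - b12)" if "2 * a20 + b11 = 0"
  proof -
    have "b11 = - 2 * a20" using that by linarith
    then have "g2 = 2 * ((1 - b30) * a02 - a20 * (2 * a21 - b12))"
      unfolding g2_def b_def by (simp add: algebra_simps)
    then show ?thesis by simp
  qed
  have center: "(nondeg_center F (1, 0) \<and> nondeg_center F (-1, 0)) \<longleftrightarrow>
      (2 * a20 + b11 = 0 \<and> (a21 + b12 = 0 \<or> (1 - b30) * a02 = a20 * (2 * a21 - b12)))"
    unfolding nondeg_center_iff tr_def k_def using pb by auto
  have "\<exists>Y. linear_planar_field Y \<and> pullback_foliation F (pbmap b30 b11 b12) Y"
    if "2 * a20 + b11 = 0" "(1 - b30) * a02 = a20 * (2 * a21 - b12)"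
    using pullback_of_linear pb that by (simp add: tr_def)
  with center F_singular
  show "let F = F in
        F (1, 0) = (0, 0) \<and> F (-1, 0) = (0, 0) \<and>
        ((nondeg_center F (1, 0) \<and> nondeg_center F (-1, 0)) \<longleftrightarrow>
           (2 * a20 + b11 = 0 \<and>
            (a21 + b12 = 0 \<or> (1 - b30) * a02 = a20 * (2 * a21 - b12)))) \<and>
        (2 * a20 + b11 = 0 \<and> (1 - b30) * a02 = a20 * (2 * a21 - b12) \<longrightarrow>
           (\<exists>Y. linear_planar_field Y \<and> pullback_foliation F (pbmap b30 b11 b12) Y))"
    by (simp add: zero_prod_def)
qed

end
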